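(* Let $\mathcal{H}$ be a reproducing kernel Hilbert space of functions on $X$ with reproducing kernel $K$, let $\lambda>0$, $\rho>0$, let $(\boldsymbol{x}_1,y_1),\dots,(\boldsymbol{x}_N,y_N)\in X\times Y$ be training data, and let $A=(K(\boldsymbol{x}_i,\boldsymbol{x}_j))_{i,j=1}^{N}$. Let $L:X\times Y\times\mathbb{R}\to[0,\infty)$ be a loss function such that for every $\boldsymbol{x}\in X$ and $y\in Y$: (a) $L(\boldsymbol{x},y,\cdot)$ is lower semi-continuous and subanalytic on $\mathbb{R}$; (b) $0\notin\partial L(\boldsymbol{x},y,0)$, where $\partial L(\boldsymbol{x},y,0)$ is the limiting subdifferential of $L(\boldsymbol{x},y,\cdot)$ at $0$. Suppose $A$ is symmetric and strictly positive definite and $\rho>4\lambda\|A^{-1}\|$. Let $\{(\boldsymbol{\alpha}^k,\boldsymbol{c}^k,\boldsymbol{\gamma}^k,s^k)\}$ be any sequence generated by the splitting method (defined in the context) initialized at $(\boldsymbol{\alpha}^0,\boldsymbol{c}^0,\boldsymbol{\gamma}^0)\in\mathbb{R}^N\times\mathbb{R}^N\times\mathbb{R}^N$, and let $s^*\in\mathcal{H}$ be the limit of $\{s^k\}$. Let $\varphi(z)=e\,z^{1-\theta}$, with a constant $e>0$ and exponent $\theta\in[0,1)$, be a function for which the Kurdyka-Lojasiewicz property of $\mathcal{L}_\rho$ on $S$ (in the form given in the context) holds. Then: (i) If $\theta=0$, then there exists an integer $n_1$ such that $s^k=s^*$ for all $k>n_1$. (ii) If $\theta\in(0,\frac12]$,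 then there exist an integer $n_2$, $C_1>0$ and $\xi\in[0,1)$ such that for all $k>n_2$, $$\|s^k-s^*\|_{\mathcal{H}}\le C_1\xi^k .$$ (iii) If $\theta\in(\frac12,1)$, then there exist an integer $n_3$ and $C_2>0$ such that for all $k>n_3$, $$\|s^k-s^*\|_{\mathcal{H}}\le C_2\,k^{\frac{1-\theta}{1-2\theta}} .$$
   Context: **Setting.** $X\subseteq\mathbb{R}^d$, $Y=\{+1,-1\}$, $N$ is a positive integer. A reproducing kernel Hilbert space (RKHS) $\mathcal{H}$ with kernel $K:X\times X\to\mathbb{R}$ is a real Hilbert space of functions $f:X\to\mathbb{R}$ with $K(\boldsymbol{x},\cdot)\in\mathcal{H}$ and $f(\boldsymbol{x})=\langle f,K(\boldsymbol{x},\cdot)\rangle_{\mathcal{H}}$ for all $\boldsymbol{x}\in X$, $f\in\mathcal{H}$. $\|\cdot\|$ is the Euclidean norm and, for matrices, the induced operator norm; $\mathrm{dist}$ is Euclidean distance. **Splitting method.** For $\boldsymbol{\alpha},\boldsymbol{c},\boldsymbol{\gamma}\in\mathbb{R}^N$ put $F(\boldsymbol{\alpha})=\frac1N\sum_{i=1}^N L(\boldsymbol{x}_i,y_i,\alpha_i)$, $G(\boldsymbol{c})=\lambda\boldsymbol{c}^TA\boldsymbol{c}$, and $$\mathcal{L}_\rho(\boldsymbol{\alpha},\boldsymbol{c},\boldsymbol{\gamma})=F(\boldsymbol{\alpha})+G(\boldsymbol{c})+\boldsymbol{\gamma}^T(\boldsymbol{\alpha}-A\boldsymbol{c})+\frac{\rho}{2}\|\boldsymbol{\alpha}-A\boldsymbol{c}\|^2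 .$$ Starting from $(\boldsymbol{\alpha}^0,\boldsymbol{c}^0,\boldsymbol{\gamma}^0)$, for $k=0,1,2,\dots$: - $\boldsymbol{\alpha}^{k+1}\in\mathrm{argmin}_{\boldsymbol{\alpha}\in\mathbb{R}^N}\mathcal{L}_\rho(\boldsymbol{\alpha},\boldsymbol{c}^k,\boldsymbol{\gamma}^k)$ (any choice of minimizer; one exists); - $\boldsymbol{c}^{k+1}\in\mathrm{argmin}_{\boldsymbol{c}\in\mathbb{R}^N}\mathcal{L}_\rho(\boldsymbol{\alpha}^{k+1},\boldsymbol{c},\boldsymbol{\gamma}^k)$, equivalently (for $A$ strictly positive definite) $\boldsymbol{c}^{k+1}$ is the solution of $(2\lambda I+\rho A)\boldsymbol{c}=\rho\boldsymbol{\alpha}^{k+1}+\boldsymbol{\gamma}^k$; - $\boldsymbol{\gamma}^{k+1}=\boldsymbol{\gamma}^k+\rho(\boldsymbol{\alpha}^{k+1}-A\boldsymbol{c}^{k+1})$, equivalently $\boldsymbol{\gamma}^{k+1}=2\lambda\boldsymbol{c}^{k+1}$; - $s^{k+1}=\sum_{i=1}^N(\boldsymbol{c}^{k+1})_iK(\boldsymbol{x}_i,\cdot)\in\mathcal{H}$. Under the stated hypotheses $\{s^k\}$ converges in $\mathcal{H}$, so $s^*$ is well defined. **Kurdyka-Lojasiewicz property on $S$.** Let $S\subseteq\mathbb{R}^{3N}$ be the set of subsequential limits of $\{(\boldsymbol{\alpha}^k,\boldsymbol{c}^k,\boldsymbol{\gamma}^k)\}$. Under the stated hypotheses $S$ is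 nonempty and compact and $\mathcal{L}_\rho$ is constant on $S$; $\mathcal{L}_\rho(S)$ denotes this constant value. The property holds for $\varphi$ if there are $\varepsilon>0$ and $\eta>0$ such that, whenever $\mathrm{dist}((\boldsymbol{\alpha},\boldsymbol{c},\boldsymbol{\gamma}),S)<\varepsilon$ and $\mathcal{L}_\rho(S)<\mathcal{L}_\rho(\boldsymbol{\alpha},\boldsymbol{c},\boldsymbol{\gamma})<\mathcal{L}_\rho(S)+\eta$, $$\varphi'\big(\mathcal{L}_\rho(\boldsymbol{\alpha},\boldsymbol{c},\boldsymbol{\gamma})-\mathcal{L}_\rho(S)\big)\ \mathrm{dist}\big(0,\partial\mathcal{L}_\rho(\boldsymbol{\alpha},\boldsymbol{c},\boldsymbol{\gamma})\big)\ge1,$$ where $\partial\mathcal{L}_\rho$ is the limiting subdifferential on $\mathbb{R}^{3N}$ (the distance to the empty set being $+\infty$). **Limiting subdifferential.** For a lower semi-continuous $f:\mathbb{R}^n\to\mathbb{R}$, the regular subdifferential $\hat\partial f(u)$ is the set of $v\in\mathbb{R}^n$ with $\liminf_{w\to u,\,w\ne u}\frac{f(w)-f(u)-v^T(w-u)}{\|w-u\|}\ge0$, and the limiting subdifferential $\partial f(u)$ is the set of $v$ for which there are $u_n\to u$ with $f(u_n)\to f(u)$ and $v_n\in\hat\partial f(u_n)$ with $v_n\to v$. **Subanalytic.** A set $B\subseteq\mathbb{R}^n$ is semianalytic if each point of $\mathbb{R}^n$ has a neighborhood $V$ such that $B\cap V$ is a finite union of finite intersections of sets $\{x\in V: g(x)=0\}$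 and $\{x\in V: h(x)>0\}$ with $g,h$ real analytic on $V$. A set $T\subseteq\mathbb{R}^n$ is subanalytic if each point of $\mathbb{R}^n$ has a neighborhood $V$ such that $T\cap V=\{x:\exists z\in\mathbb{R}^m,\ (x,z)\in B\}$ for some bounded semianalytic $B\subseteq\mathbb{R}^n\times\mathbb{R}^m$. A function $f:\mathbb{R}^n\to\mathbb{R}$ is subanalytic if its graph is a subanalytic subset of $\mathbb{R}^n\times\mathbb{R}$. *)

theory Defs
  imports "HOL-Analysis.Analysis"
begin

section \<open>Reproducing kernel Hilbert spaces\<close>

text \<open>The Hilbert space is a type \<open>'h\<close>, whose elements are identified with functions on \<open>X\<close>
  through the evaluation map \<open>ev\<close>: it is linear, and an element is determined by its values
  on \<open>X\<close>.  Only the values of \<open>ev f\<close> on \<open>X\<close> and of \<open>K\<close> on \<open>X \<times> X\<close> matter.\<close>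

definition rkhs ::
  "'x set \<Rightarrow> ('h::{real_inner,complete_space} \<Rightarrow> 'x \<Rightarrow> real) \<Rightarrow> ('x \<Rightarrow> 'x \<Rightarrow> real) \<Rightarrow> bool"
where
  "rkhs X ev K \<longleftrightarrow>
     (\<forall>x\<in>X. linear (\<lambda>f. ev f x)) \<and>
     (\<forall>f g. (\<forall>x\<in>X. ev f x = ev g x) \<longrightarrow> f = g) \<and>
     (\<forall>x\<in>X. \<exists>k. (\<forall>t\<in>X. ev k t = K x t) \<and> (\<forall>f. ev f x = f \<bullet> k))"


section \<open>Lower semicontinuity and subdifferentials\<close>

definition lsc :: "('a::topological_space \<Rightarrow> real) \<Rightarrow> bool" where
  "lsc f \<longleftrightarrow> (\<forall>u. ereal (f u) \<le> Liminf (at u) (\<lambda>w. ereal (f w)))"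

definition regular_subdiff :: "('a::euclidean_space \<Rightarrow> real) \<Rightarrow> 'a \<Rightarrow> 'a set" where
  "regular_subdiff f u =
     {v. 0 \<le> Liminf (at u) (\<lambda>w. ereal ((f w - f u - v \<bullet> (w - u)) / norm (w - u)))}"

definition limiting_subdiff :: "('a::euclidean_space \<Rightarrow> real) \<Rightarrow> 'a \<Rightarrow> 'a set" where
  "limiting_subdiff f u =
     {v. \<exists>us vs. us \<longlonglongrightarrow> u \<and> (\<lambda>n. f (us n)) \<longlonglongrightarrow> f u \<and>
           (\<forall>n. vs n \<in> regular_subdiff f (us n)) \<and> vs \<longlonglongrightarrow> v}"


section \<open>Subanalytic sets and functions\<close>

text \<open>The dimension of the projected-out space in the definition of a subanalytic set is
  existentially quantified, so \<open>\<real>\<^sup>n\<close> is taken to be the topological space \<open>Euclidean_space n\<close>,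
  whose points are the sequences \<open>x :: nat \<Rightarrow> real\<close> with \<open>x i = 0\<close> for \<open>i \<ge> n\<close>.
  Neighbourhoods are open.\<close>

text \<open>Local expansion into an (absolutely convergent) power series in \<open>n\<close> variables; the
  exponents are the multi-indices supported on \<open>{..<n}\<close>.\<close>

definition real_analytic_on :: "nat \<Rightarrow> ((nat \<Rightarrow> real) \<Rightarrow> real) \<Rightarrow> (nat \<Rightarrow> real) set \<Rightarrow> bool" where
  "real_analytic_on n g V \<longleftrightarrow>
     (\<forall>p\<in>V. \<exists>a W. openin (Euclidean_space n) W \<and> p \<in> W \<and>
        (\<forall>x\<in>W. ((\<lambda>\<mu>. a \<mu> * (\<Prod>i<n. (x i - p i) ^ \<mu> i)) has_sum g x)
                 {\<mu>::nat \<Rightarrow> nat. \<forall>i\<ge>n. \<mu> i = 0}))"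

text \<open>Each pair \<open>(P, Q)\<close> in \<open>\<C>\<close> encodes one finite intersection of zero sets of functions in
  \<open>P\<close> and strict positivity sets of functions in \<open>Q\<close>.\<close>

definition semianalytic :: "nat \<Rightarrow> (nat \<Rightarrow> real) set \<Rightarrow> bool" where
  "semianalytic n B \<longleftrightarrow>
     B \<subseteq> topspace (Euclidean_space n) \<and>
     (\<forall>p\<in>topspace (Euclidean_space n). \<exists>V. openin (Euclidean_space n) V \<and> p \<in> V \<and>
        (\<exists>\<C>. finite \<C> \<and>
           (\<forall>(P, Q)\<in>\<C>. finite P \<and> finite Q \<and> (\<forall>g\<in>P \<union> Q. real_analytic_on n g V)) \<and>
           B \<inter> V = (\<Union>(P, Q)\<in>\<C>. {x\<in>V. (\<forall>g\<in>P. g x = 0) \<and> (\<forall>h\<in>Q. h x > 0)})))"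

definition pair_point :: "nat \<Rightarrow> (nat \<Rightarrow> real) \<Rightarrow> (nat \<Rightarrow> real) \<Rightarrow> nat \<Rightarrow> real" where
  "pair_point n x z = (\<lambda>i. if i < n then x i else z (i - n))"

definition subanalytic :: "nat \<Rightarrow> (nat \<Rightarrow> real) set \<Rightarrow> bool" where
  "subanalytic n T \<longleftrightarrow>
     T \<subseteq> topspace (Euclidean_space n) \<and>
     (\<forall>p\<in>topspace (Euclidean_space n). \<exists>V. openin (Euclidean_space n) V \<and> p \<in> V \<and>
        (\<exists>m B. semianalytic (n + m) B \<and> (\<exists>b. \<forall>w\<in>B. L2_set w {..<n + m} \<le> b) \<and>
           T \<inter> V = {x \<in> topspace (Euclidean_space n).
                      \<exists>z\<in>topspace (Euclidean_space m). pair_point n x z \<in> B}))"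

text \<open>The set below is the graph, the function value being stored in coordinate \<open>n\<close>.\<close>

definition subanalytic_fun :: "nat \<Rightarrow> ((nat \<Rightarrow> real) \<Rightarrow> real) \<Rightarrow> bool" where
  "subanalytic_fun n f \<longleftrightarrow>
     subanalytic (n + 1) ((\<lambda>x. x(n := f x)) ` topspace (Euclidean_space n))"


section \<open>The splitting method\<close>

definition kernel_matrix :: "('x \<Rightarrow> 'x \<Rightarrow> real) \<Rightarrow> ('n \<Rightarrow> 'x) \<Rightarrow> real^'n^'n" where
  "kernel_matrix K xs = (\<chi> i j. K (xs i) (xs j))"

definition strictly_pos_def :: "real^'n^'n \<Rightarrow> bool" where
  "strictly_pos_def A \<longleftrightarrow> (\<forall>v. v \<noteq> 0 \<longrightarrow> v \<bullet> (A *v v) > 0)"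

definition empirical_loss ::
  "('x \<Rightarrow> real \<Rightarrow> real \<Rightarrow> real) \<Rightarrow> ('n::finite \<Rightarrow> 'x) \<Rightarrow> ('n \<Rightarrow> real) \<Rightarrow> real^'n \<Rightarrow> real"
where
  "empirical_loss L xs ys \<alpha> = 1 / real CARD('n) * (\<Sum>i\<in>UNIV. L (xs i) (ys i) (\<alpha> $ i))"

text \<open>The norm of the product type \<open>real^'n \<times> real^'n \<times> real^'n\<close> is the Euclidean norm of
  \<open>\<real>\<^sup>3\<^sup>N\<close>.\<close>

definition aug_lagrangian ::
  "(real^'n::finite \<Rightarrow> real) \<Rightarrow> real^'n^'n \<Rightarrow> real \<Rightarrow> real \<Rightarrow> (real^'n) \<times> (real^'n) \<times> (real^'n) \<Rightarrow> real"
where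
  "aug_lagrangian F A lam \<rho> = (\<lambda>(\<alpha>, c, \<gamma>).
     F \<alpha> + lam * (c \<bullet> (A *v c)) + \<gamma> \<bullet> (\<alpha> - A *v c) + \<rho> / 2 * (norm (\<alpha> - A *v c))\<^sup>2)"

definition splitting_iterates ::
  "(real^'n::finite \<Rightarrow> real) \<Rightarrow> real^'n^'n \<Rightarrow> real \<Rightarrow> real \<Rightarrow>
   (nat \<Rightarrow> real^'n) \<Rightarrow> (nat \<Rightarrow> real^'n) \<Rightarrow> (nat \<Rightarrow> real^'n) \<Rightarrow> bool"
where
  "splitting_iterates F A lam \<rho> \<alpha> c \<gamma> \<longleftrightarrow> (\<forall>k.
     is_arg_min (\<lambda>a. aug_lagrangian F A lam \<rho> (a, c k, \<gamma> k)) (\<lambda>_. True) (\<alpha> (Suc k)) \<and>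
     is_arg_min (\<lambda>b. aug_lagrangian F A lam \<rho> (\<alpha> (Suc k), b, \<gamma> k)) (\<lambda>_. True) (c (Suc k)) \<and>
     \<gamma> (Suc k) = \<gamma> k + \<rho> *\<^sub>R (\<alpha> (Suc k) - A *v c (Suc k)))"


section \<open>The Kurdyka-Lojasiewicz property\<close>

definition subseq_limits :: "(nat \<Rightarrow> 'a::topological_space) \<Rightarrow> 'a set" where
  "subseq_limits u = {l. \<exists>r. strict_mono r \<and> (u \<circ> r) \<longlonglongrightarrow> l}"

text \<open>Unlike with \<^const>\<open>infdist\<close>, the distance to the empty set is \<open>\<infinity>\<close>.\<close>

definition ext_dist :: "'a::metric_space \<Rightarrow> 'a set \<Rightarrow> ereal" where
  "ext_dist u S = (INF v\<in>S. ereal (dist u v))"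

definition value_on :: "('a \<Rightarrow> real) \<Rightarrow> 'a set \<Rightarrow> real" where
  "value_on f S = (THE l. f ` S = {l})"

definition KL_property :: "('a::euclidean_space \<Rightarrow> real) \<Rightarrow> 'a set \<Rightarrow> (real \<Rightarrow> real) \<Rightarrow> bool" where
  "KL_property f S \<phi> \<longleftrightarrow> (\<exists>\<epsilon>>0. \<exists>\<eta>>0. \<forall>u.
     ext_dist u S < ereal \<epsilon> \<and> value_on f S < f u \<and> f u < value_on f S + \<eta> \<longrightarrow>
     ereal (deriv \<phi> (f u - value_on f S)) * ext_dist 0 (limiting_subdiff f u) \<ge> 1)"

end

theory Submission
  imports Defs
begin

text \<open>The multiplier satisfies \<open>\<gamma> k = 2 * lam * c k\<close>, so by the lower bound on \<open>\<rho>\<close> each iteration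
  decreases the augmented Lagrangian by at least a multiple of \<open>\<parallel>c (k+1) - c k\<parallel>\<^sup>2\<close>, while it has a
  subgradient at the new iterate of size at most a multiple of \<open>\<parallel>c (k+1) - c k\<parallel>\<close>. The values of
  the Lagrangian decrease to their value on the limit set. If they reach it, the coefficients are
  eventually constant. Otherwise the Kurdyka-Lojasiewicz inequality turns these two bounds
  into a recursion for the gap between value and limit, whose decay (linear or polynomial, according
  to the exponent) controls the tails of \<open>\<Sum>k. \<parallel>c (k+1) - c k\<parallel>\<close>. Since \<open>s k\<close> is a fixed linear image of
  \<open>c k\<close>, the rate carries over to the Hilbert space.\<close>

section \<open>Rates for sequences with sufficient decrease\<close>

text \<open>\<open>F\<close> may be nonconvex and discontinuous, so its subgradients at the iterates
  come from minimality alone: the \<alpha>-step gives \<open>F\<close> a quadratic minorant at the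
  new point, and with the quadratic coupling added this yields a minorant of the whole Lagrangian,
  whose slope is a regular subgradient. The descent is a balance: the c-step gains a multiple of |c
  (k+1) - c k|^2, while the multiplier step costs |\<gamma> (k+1) - \<gamma> k|^2 / \<rho>. The
  factor 4 in the bound on \<rho> is the one that coercivity asks for: half of the quadratic form in
  \<open>c\<close> has to absorb a cross term of indefinite sign. Coercivity bounds the iterates, so
  that they approach their limit set. The initial triple is arbitrary, and the identity for the
  multiplier holds from index 1 on; hence the recurring \<open>k > 0\<close>. The exponents split at
  1/2 because the gap r satisfies r (k+1)^(2\<theta>) \<le> const * (r k - r (k+1)): once r \<le> 1,
  this contracts geometrically for \<theta> \<le> 1/2, and for \<theta> > 1/2 it makes
  r^(1-2\<theta>) grow linearly. Tails are bounded by r^(1-\<theta>), which yields the exponent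
  (1-\<theta>)/(1-2\<theta>).\<close>

lemma convergent_of_telescoping_bound:
  fixes x :: "nat \<Rightarrow> 'a::{real_normed_vector,complete_space}" and E :: "nat \<Rightarrow> real"
  assumes step: "\<And>k. k \<ge> n \<Longrightarrow> norm (x (Suc k) - x k) \<le> E k - E (Suc k)"
    and nonneg: "\<And>k. k \<ge> n \<Longrightarrow> 0 \<le> E k"
  obtains l where "x \<longlonglongrightarrow> l" "\<And>k. k \<ge> n \<Longrightarrow> norm (x k - l) \<le> E k"
proof -
  \<comment> \<open>Decrements of \<open>E\<close> telescope along the path. As \<open>E\<close>
    decreases and is bounded below, it is Cauchy, and this bound passes the property on to
    \<open>x\<close>.\<close>
  have bound: "norm (x (i + j) - x i) \<le> E i - E (i + j)" if "i \<ge> n" for i j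
  proof (induction j)
    case (Suc j)
    have "norm (x (Suc (i + j)) - x i) \<le> norm (x (Suc (i + j)) - x (i + j)) + norm (x (i + j) - x i)"
      by norm
    then show ?case using Suc step[of "i + j"] that by simp
  qed simp
  have dec: "decseq (\<lambda>k. E (k + n))"
    using step by (intro decseq_SucI) (smt (verit) add_Suc le_add2 norm_ge_zero)
  have "convergent (\<lambda>k. E (k + n))"
    using decseq_convergent[OF dec, of 0] nonneg by (metis convergentI le_add2)
  then have "Cauchy (\<lambda>k. E (k + n))" by (rule convergent_Cauchy)
  have "Cauchy (\<lambda>k. x (k + n))"
  proof (rule metric_CauchyI)
    fix e :: real assume "e > 0"
    then obtain M where M: "\<And>i j. i \<ge> M \<Longrightarrow> j \<ge> M \<Longrightarrow> dist (E (i + n)) (E (j + n)) < e"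
      using \<open>Cauchy (\<lambda>k. E (k + n))\<close> by (metis metric_CauchyD)
    have *: "dist (x (i + n)) (x (j + n)) < e" if "i \<ge> M" "j \<ge> i" for i j
      using bound[of "i + n" "j - i"] M[of i j] that
      by (simp add: dist_norm norm_minus_commute add.commute)
    show "\<exists>M. \<forall>i\<ge>M. \<forall>j\<ge>M. dist (x (i + n)) (x (j + n)) < e"
      using * by (metis dist_commute nat_le_linear)
  qed
  then obtain l where "(\<lambda>k. x (k + n)) \<longlonglongrightarrow> l"
    using Cauchy_convergent convergent_def by blast
  then have lim: "x \<longlonglongrightarrow> l" by (rule LIMSEQ_offset)
  have "norm (x k - l) \<le> E k" if "k \<ge> n" for k
  proof (rule tendsto_upperbound)
    show "(\<lambda>j. norm (x k - x (k + j))) \<longlonglongrightarrow> norm (x k - l)"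
      using LIMSEQ_ignore_initial_segment[OF lim, of k] by (intro tendsto_intros) (simp add: add.commute)
    show "\<forall>\<^sub>F j in sequentially. norm (x k - x (k + j)) \<le> E k"
    proof (rule always_eventually, rule allI)
      fix j show "norm (x k - x (k + j)) \<le> E k"
        using bound[OF that, of j] nonneg[of "k + j"] that by (simp add: norm_minus_commute)
    qed
  qed simp
  with lim that show thesis by blast
qed

text \<open>Concavity: the graph of t^(1-\<theta>) lies below its tangent at \<open>a\<close>. It
  turns a decrease of the gap into a decrease of its power 1-\<theta>, which can be
  telescoped.\<close>

lemma powr_diff_ge_tangent:
  fixes a b \<theta> :: real
  assumes "0 < b" "0 < a" "0 < \<theta>" "\<theta> < 1"
  shows "(1 - \<theta>) * (a - b) \<le> a powr \<theta> * (a powr (1 - \<theta>) - b powr (1 - \<theta>))"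
proof -
  have "b powr (1 - \<theta>) * a powr \<theta> \<le> (1 - \<theta>) * b + \<theta> * a"
    using Youngs_inequality_0[of "1 - \<theta>" \<theta> b a] assms by simp
  moreover have "a powr \<theta> * a powr (1 - \<theta>) = a"
    using assms by (simp add: powr_add[symmetric])
  ultimately show ?thesis by (simp add: algebra_simps)
qed

text \<open>For p < 1 Bernoulli's inequality points the wrong way, so a slope smaller than
  \<open>p * m\<close> is needed. Weighted AM-GM for z^(1-p) * 1^p gives z^p \<ge> z / ((1-p) z +
  p), and the denominator is at most 1 + m.\<close>

lemma powr_one_plus_ge:
  fixes p m x :: real
  assumes "0 < p" "p < 1" "0 < m" "0 \<le> x" "x \<le> 1"
  shows "1 + p * m / (1 + m) * x \<le> (1 + m * x) powr p"
proof -
  define z where "z = 1 + m * x"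
  have z: "1 \<le> z" "z \<le> 1 + m" using assms by (auto simp: z_def mult_left_le)
  have "p \<le> p * z" using z assms by simp
  with z have "(1 - p) * z + p \<le> 1 + m"
    unfolding left_diff_distrib by linarith
  moreover have "0 < (1 - p) * z + p"
    using z assms by (intro add_nonneg_pos) auto
  ultimately have den: "0 < (1 - p) * z + p" "(1 - p) * z + p \<le> 1 + m" by auto
  have "z powr (1 - p) * 1 powr p \<le> (1 - p) * z + p * 1"
    using Youngs_inequality_0[of "1 - p" p z 1] assms z by simp
  then have "z powr p * z powr (1 - p) \<le> z powr p * ((1 - p) * z + p)"
    by (intro mult_left_mono) auto
  then have "z \<le> z powr p * ((1 - p) * z + p)"
    using z by (simp add: powr_add[symmetric])
  then have "z / ((1 - p) * z + p) \<le> z powr p"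
    using den by (simp add: divide_le_eq)
  moreover have "z / ((1 - p) * z + p) = 1 + p * (m * x) / ((1 - p) * z + p)"
    using den by (simp add: field_simps z_def)
  moreover have "p * (m * x) / (1 + m) \<le> p * (m * x) / ((1 - p) * z + p)"
    using den assms by (intro divide_left_mono) auto
  ultimately show ?thesis by (simp add: z_def)
qed

text \<open>The Kurdyka-Lojasiewicz bound at index k involves the previous step length. Combined
  with descent and concavity it bounds the square of the new step by the previous step times a
  telescoping term, and AM-GM separates the two factors.\<close>

lemma KL_descent_limit:
  fixes x :: "nat \<Rightarrow> 'a::{real_normed_vector,complete_space}" and r :: "nat \<Rightarrow> real"
  assumes m: "m > 0" and B: "B > 0" and \<theta>: "1/2 \<le> \<theta>" "\<theta> < 1"
    and r_pos: "\<And>k. k \<ge> n \<Longrightarrow> 0 < r k" and r_le: "\<And>k. k \<ge> n \<Longrightarrow> r k \<le> 1"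
    and descent: "\<And>k. k \<ge> n \<Longrightarrow> m * (norm (x (Suc k) - x k))\<^sup>2 \<le> r k - r (Suc k)"
    and KL: "\<And>k. k \<ge> n \<Longrightarrow> r (Suc k) powr \<theta> \<le> B * norm (x (Suc k) - x k)"
  obtains l C where "x \<longlonglongrightarrow> l" "C > 0"
    "\<And>k. k \<ge> n \<Longrightarrow> norm (x (Suc k) - l) \<le> C * r k powr (1 - \<theta>)"
proof -
  define d where "d = (\<lambda>k. norm (x (Suc k) - x k))"
  define D where "D = B / (m * (1 - \<theta>))"
  \<comment> \<open>AM-GM will give 2 d (k+1) \<le> d k + D * w with \<open>w\<close> the decrement
    of the power of \<open>r\<close>; moving one d (k+1) to the right shows that \<open>E\<close> is
    the potential whose decrement dominates the step.\<close>
  define E where "E = (\<lambda>k. d k + D * r (Suc k) powr (1 - \<theta>))"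
  have D: "D > 0" using assms by (simp add: D_def)
  have step: "norm (x (Suc (Suc k)) - x (Suc k)) \<le> E k - E (Suc k)" if k: "k \<ge> n" for k
  proof -
    define w where "w = r (Suc k) powr (1 - \<theta>) - r (Suc (Suc k)) powr (1 - \<theta>)"
    have pos: "0 < r (Suc k)" "0 < r (Suc (Suc k))" using r_pos k by auto
    have "0 \<le> m * (d (Suc k))\<^sup>2" using m by simp
    moreover have dsc: "m * (d (Suc k))\<^sup>2 \<le> r (Suc k) - r (Suc (Suc k))"
      using descent[of "Suc k"] k by (simp add: d_def)
    ultimately have "0 \<le> w"
      using pos \<theta> unfolding w_def by (simp add: powr_mono2)
    have "(1 - \<theta>) * (m * (d (Suc k))\<^sup>2) \<le> (1 - \<theta>) * (r (Suc k) - r (Suc (Suc k)))"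
      using dsc \<theta> by (intro mult_left_mono) auto
    also have "\<dots> \<le> r (Suc k) powr \<theta> * w"
      unfolding w_def using pos \<theta> by (intro powr_diff_ge_tangent) auto
    also have "\<dots> \<le> B * d k * w"
      using KL[OF k] \<open>0 \<le> w\<close> unfolding d_def by (intro mult_right_mono) auto
    finally have "(d (Suc k))\<^sup>2 \<le> d k * (D * w)"
      using m \<theta> by (simp add: D_def field_simps)
    moreover have "d k * (D * w) \<le> ((d k + D * w) / 2)\<^sup>2"
      using zero_le_power2[of "d k - D * w"] by (simp add: power2_eq_square field_simps)
    ultimately have "(d (Suc k))\<^sup>2 \<le> ((d k + D * w) / 2)\<^sup>2" by linarith
    then have "d (Suc k) \<le> (d k + D * w) / 2"
      by (rule power2_le_imp_le) (use D \<open>0 \<le> w\<close> in \<open>simp add: d_def\<close>)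
    then have "d (Suc k) \<le> E k - E (Suc k)"
      by (simp add: E_def w_def right_diff_distrib)
    then show ?thesis by (simp add: d_def)
  qed
  have "E k \<ge> 0" for k using D by (simp add: E_def d_def)
  then obtain l where l: "(\<lambda>k. x (Suc k)) \<longlonglongrightarrow> l" "\<And>k. k \<ge> n \<Longrightarrow> norm (x (Suc k) - l) \<le> E k"
    using convergent_of_telescoping_bound[of n "\<lambda>k. x (Suc k)" E] step by blast
  show thesis
  proof
    show "x \<longlonglongrightarrow> l" using l(1) by (simp add: filterlim_sequentially_Suc)
    show "1 / sqrt m + D > 0" using m D by (simp add: add_pos_pos)
    fix k assume k: "k \<ge> n"
    have pos: "0 < r k" "0 < r (Suc k)" using r_pos k by auto
    have "0 \<le> m * (d k)\<^sup>2" using m by simp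
    then have dec: "r (Suc k) \<le> r k" using descent[OF k] unfolding d_def by linarith
    have "m * (d k)\<^sup>2 \<le> r k" using descent[OF k] pos unfolding d_def by linarith
    then have "sqrt (m * (d k)\<^sup>2) \<le> sqrt (r k)" by simp
    then have "d k \<le> 1 / sqrt m * r k powr (1/2)"
      using m pos by (simp add: real_sqrt_mult d_def field_simps powr_half_sqrt)
    \<comment> \<open>For a base at most 1 the smaller exponent gives the larger power, and
      1-\<theta> \<le> 1/2.\<close>
    also have "r k powr (1/2) \<le> r k powr (1 - \<theta>)"
      using pos r_le[OF k] \<theta> by (intro powr_mono') auto
    finally have "d k \<le> 1 / sqrt m * r k powr (1 - \<theta>)"
      using m by (simp add: divide_right_mono)
    moreover have "D * r (Suc k) powr (1 - \<theta>) \<le> D * r k powr (1 - \<theta>)"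
      using D dec pos \<theta> by (simp add: powr_mono2)
    ultimately show "norm (x (Suc k) - l) \<le> (1 / sqrt m + D) * r k powr (1 - \<theta>)"
      using l(2)[OF k] by (simp add: E_def distrib_right)
  qed
qed

section \<open>Decay of the gap and the resulting rates\<close>

lemma geometric_decay:
  fixes r :: "nat \<Rightarrow> real"
  assumes "m > 0" and "\<And>k. k \<ge> n \<Longrightarrow> m * r (Suc k) \<le> r k - r (Suc k)"
  shows "r (n + j) \<le> (1 / (1 + m)) ^ j * r n"
proof (induction j)
  case (Suc j)
  have "r (Suc (n + j)) * (1 + m) \<le> r (n + j)"
    using assms(2)[of "n + j"] by (simp add: algebra_simps)
  then have "r (Suc (n + j)) \<le> 1 / (1 + m) * r (n + j)"
    using assms(1) by (simp add: field_simps)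
  also have "\<dots> \<le> 1 / (1 + m) * ((1 / (1 + m)) ^ j * r n)"
    using Suc assms(1) by (intro mult_left_mono) auto
  finally show ?case by simp
qed simp

text \<open>Discrete form of the equation r' = -m r^(1+p), along whose solutions r^(-p) grows at a
  constant rate. The conclusion is written as a product, so that it also makes sense at j =
  0.\<close>

lemma sublinear_decay:
  fixes r :: "nat \<Rightarrow> real"
  assumes m: "m > 0" and p: "0 < p" "p < 1"
    and r_pos: "\<And>k. k \<ge> n \<Longrightarrow> 0 < r k" and r_le: "\<And>k. k \<ge> n \<Longrightarrow> r k \<le> 1"
    and dec: "\<And>k. k \<ge> n \<Longrightarrow> m * r (Suc k) powr (1 + p) \<le> r k - r (Suc k)"
  obtains \<nu> where "\<nu> > 0" "\<And>j. r (n + j) powr p * (\<nu> * real j) \<le> 1"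
proof -
  define \<mu> where "\<mu> = p * m / (1 + m)"
  have \<mu>: "\<mu> > 0" using m p by (simp add: \<mu>_def)
  define y where "y = (\<lambda>k. r k powr p)"
  have y: "0 < y k" "y k \<le> 1" if "k \<ge> n" for k
    using r_pos[OF that] r_le[OF that] p by (auto simp: y_def powr_le1)
  have step: "1 / y k + \<mu> / (1 + \<mu>) \<le> 1 / y (Suc k)" if k: "k \<ge> n" for k
  proof -
    have y': "0 < y (Suc k)" "y (Suc k) \<le> 1" using y k by auto
    have pos: "0 < r (Suc k)" using r_pos k by auto
    have "r (Suc k) * (1 + m * y (Suc k)) \<le> r k"
      using dec[OF k] pos by (simp add: y_def powr_add algebra_simps)
    then have "(r (Suc k) * (1 + m * y (Suc k))) powr p \<le> r k powr p"
      using p pos m y' by (intro powr_mono2) auto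
    then have "y (Suc k) * (1 + m * y (Suc k)) powr p \<le> y k"
      using pos m y' by (simp add: powr_mult y_def)
    moreover have "1 + \<mu> * y (Suc k) \<le> (1 + m * y (Suc k)) powr p"
      unfolding \<mu>_def using powr_one_plus_ge[of p m "y (Suc k)"] p m y' by simp
    ultimately have le: "y (Suc k) * (1 + \<mu> * y (Suc k)) \<le> y k"
      by (smt (verit) mult_left_mono y'(1))
    have pos2: "0 < 1 + \<mu> * y (Suc k)" using \<mu> y' by (simp add: add_pos_pos)
    have "1 / y k \<le> 1 / (y (Suc k) * (1 + \<mu> * y (Suc k)))"
      using le pos2 y' y[OF k] by (intro divide_left_mono) auto
    \<comment> \<open>Partial fractions isolate the increment of 1/y, which \<open>y \<le> 1\<close>
      then bounds below uniformly in k.\<close>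
    also have "\<dots> = 1 / y (Suc k) - \<mu> / (1 + \<mu> * y (Suc k))"
      using pos2 y' by (simp add: field_simps)
    finally have "1 / y k \<le> 1 / y (Suc k) - \<mu> / (1 + \<mu> * y (Suc k))" .
    moreover have "\<mu> / (1 + \<mu>) \<le> \<mu> / (1 + \<mu> * y (Suc k))"
      using \<mu> y' pos2 by (intro divide_left_mono) auto
    ultimately show ?thesis by simp
  qed
  have "\<mu> / (1 + \<mu>) * real j \<le> 1 / y (n + j)" for j
  proof (induction j)
    case 0
    then show ?case using y[of n] by simp
  next
    case (Suc j)
    then show ?case using step[of "n + j"] by (simp add: algebra_simps add_divide_distrib)
  qed
  then have "y (n + j) * (\<mu> / (1 + \<mu>) * real j) \<le> 1" for j
    using y[of "n + j"] by (metis le_add1 mult.commute pos_le_divide_eq)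
  with \<mu> that[of "\<mu> / (1 + \<mu>)"] show thesis by (simp add: y_def)
qed

lemma KL_linear_rate:
  fixes x :: "nat \<Rightarrow> 'a::{real_normed_vector,complete_space}" and r :: "nat \<Rightarrow> real"
  assumes m: "m > 0" and B: "B > 0"
    and r_pos: "\<And>k. k \<ge> n \<Longrightarrow> 0 < r k" and r_le: "\<And>k. k \<ge> n \<Longrightarrow> r k \<le> 1"
    and descent: "\<And>k. k \<ge> n \<Longrightarrow> m * (norm (x (Suc k) - x k))\<^sup>2 \<le> r k - r (Suc k)"
    and KL: "\<And>k. k \<ge> n \<Longrightarrow> r (Suc k) powr (1/2) \<le> B * norm (x (Suc k) - x k)"
  obtains l C \<xi> where "x \<longlonglongrightarrow> l" "C > 0" "0 \<le> \<xi>" "\<xi> < 1"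
    "\<And>k. k > n \<Longrightarrow> norm (x k - l) \<le> C * \<xi> ^ k"
proof -
  have half: "1 / 2 \<le> (1 / 2 :: real)" "1 / 2 < (1::real)" by simp_all
  obtain l C where l: "x \<longlonglongrightarrow> l" "C > 0"
    and bound: "\<And>k. k \<ge> n \<Longrightarrow> norm (x (Suc k) - l) \<le> C * r k powr (1 - 1/2)"
    using KL_descent_limit[where x = x and r = r and n = n, OF m B half r_pos r_le descent KL] by blast
  define \<mu> where "\<mu> = m / B\<^sup>2"
  have \<mu>: "\<mu> > 0" using m B by (simp add: \<mu>_def)
  have "\<mu> * r (Suc k) \<le> r k - r (Suc k)" if k: "k \<ge> n" for k
  proof -
    have pos: "0 < r (Suc k)" using r_pos k by auto
    then have "sqrt (r (Suc k)) \<le> B * norm (x (Suc k) - x k)"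
      using KL[OF k] by (simp add: powr_half_sqrt)
    then have "(sqrt (r (Suc k)))\<^sup>2 \<le> (B * norm (x (Suc k) - x k))\<^sup>2"
      using pos by (intro power_mono) auto
    then have "r (Suc k) \<le> B\<^sup>2 * (norm (x (Suc k) - x k))\<^sup>2"
      using pos by (simp add: power_mult_distrib)
    then have "\<mu> * r (Suc k) \<le> \<mu> * (B\<^sup>2 * (norm (x (Suc k) - x k))\<^sup>2)"
      using \<mu> by (intro mult_left_mono) auto
    also have "\<dots> = m * (norm (x (Suc k) - x k))\<^sup>2" using B by (simp add: \<mu>_def)
    finally show ?thesis using descent[OF k] by linarith
  qed
  from geometric_decay[where r = r and n = n, OF \<mu> this]
  have geo: "r (n + j) \<le> (1 / (1 + \<mu>)) ^ j * r n" for j .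
  \<comment> \<open>The gap contracts by 1/(1+\<mu>), but the distance is controlled by the square
    root of the gap.\<close>
  define \<xi> where "\<xi> = sqrt (1 / (1 + \<mu>))"
  have \<xi>: "0 < \<xi>" "\<xi> < 1" using \<mu> by (auto simp: \<xi>_def real_sqrt_divide)
  show thesis
  proof
    \<comment> \<open>The division compensates the shift k = n + 1 + j, since the decay starts at
      index n and the distance bound lags by one.\<close>
    show "C / \<xi> ^ Suc n > 0" using l(2) \<xi> by simp
    fix k assume "k > n"
    then obtain j where k: "k = Suc (n + j)" using less_imp_Suc_add by blast
    have "r (n + j) \<le> (1 / (1 + \<mu>)) ^ j * r n" by (rule geo)
    also have "\<dots> \<le> (1 / (1 + \<mu>)) ^ j"
      using \<mu> r_le[of n] by (intro mult_right_le_one_le) (auto simp: less_imp_le r_pos)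
    finally have "sqrt (r (n + j)) \<le> \<xi> ^ j"
      unfolding \<xi>_def real_sqrt_power[symmetric] by (rule real_sqrt_le_mono)
    then have "r (n + j) powr (1 - 1/2) \<le> \<xi> ^ j"
      using r_pos[of "n + j"] by (simp add: powr_half_sqrt)
    then have "C * r (n + j) powr (1 - 1/2) \<le> C * \<xi> ^ j"
      using l(2) by (intro mult_left_mono) auto
    also have "\<dots> = C / \<xi> ^ Suc n * \<xi> ^ k"
      using \<xi> by (simp add: k power_add)
    finally show "norm (x k - l) \<le> C / \<xi> ^ Suc n * \<xi> ^ k"
      using bound[of "n + j"] by (simp add: k)
  qed (use l \<xi> in auto)
qed

lemma KL_sublinear_rate:
  fixes x :: "nat \<Rightarrow> 'a::{real_normed_vector,complete_space}" and r :: "nat \<Rightarrow> real"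
  assumes m: "m > 0" and B: "B > 0" and \<theta>: "1/2 < \<theta>" "\<theta> < 1"
    and r_pos: "\<And>k. k \<ge> n \<Longrightarrow> 0 < r k" and r_le: "\<And>k. k \<ge> n \<Longrightarrow> r k \<le> 1"
    and descent: "\<And>k. k \<ge> n \<Longrightarrow> m * (norm (x (Suc k) - x k))\<^sup>2 \<le> r k - r (Suc k)"
    and KL: "\<And>k. k \<ge> n \<Longrightarrow> r (Suc k) powr \<theta> \<le> B * norm (x (Suc k) - x k)"
  obtains l C where "x \<longlonglongrightarrow> l" "C > 0"
    "\<And>k. k > 2 * n + 2 \<Longrightarrow> norm (x k - l) \<le> C * real k powr ((1 - \<theta>) / (1 - 2 * \<theta>))"
proof -
  have "1/2 \<le> \<theta>" using \<theta> by simp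
  obtain l C where l: "x \<longlonglongrightarrow> l" "C > 0"
    and bound: "\<And>k. k \<ge> n \<Longrightarrow> norm (x (Suc k) - l) \<le> C * r k powr (1 - \<theta>)"
    using KL_descent_limit[where x = x and r = r and n = n, OF m B \<open>1/2 \<le> \<theta>\<close> \<theta>(2) r_pos r_le descent KL] by blast
  define \<mu> where "\<mu> = m / B\<^sup>2"
  have \<mu>: "\<mu> > 0" using m B by (simp add: \<mu>_def)
  \<comment> \<open>Squaring the Kurdyka-Lojasiewicz bound produces the power 2\<theta> = 1 +
    p.\<close>
  define p where "p = 2 * \<theta> - 1"
  have p: "0 < p" "p < 1" using \<theta> by (auto simp: p_def)
  have "\<mu> * r (Suc k) powr (1 + p) \<le> r k - r (Suc k)" if k: "k \<ge> n" for k
  proof -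
    have pos: "0 < r (Suc k)" using r_pos k by auto
    have "(r (Suc k) powr \<theta>)\<^sup>2 \<le> (B * norm (x (Suc k) - x k))\<^sup>2"
      using KL[OF k] by (intro power_mono) auto
    moreover have "(r (Suc k) powr \<theta>)\<^sup>2 = r (Suc k) powr (1 + p)"
      by (simp add: power2_eq_square p_def powr_add[symmetric])
    ultimately have "r (Suc k) powr (1 + p) \<le> B\<^sup>2 * (norm (x (Suc k) - x k))\<^sup>2"
      by (simp add: power_mult_distrib)
    then have "\<mu> * r (Suc k) powr (1 + p) \<le> \<mu> * (B\<^sup>2 * (norm (x (Suc k) - x k))\<^sup>2)"
      using \<mu> by (intro mult_left_mono) auto
    also have "\<dots> = m * (norm (x (Suc k) - x k))\<^sup>2" using B by (simp add: \<mu>_def)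
    finally show ?thesis using descent[OF k] by linarith
  qed
  from sublinear_decay[where r = r and n = n, OF \<mu> p r_pos r_le this]
  obtain \<nu> where \<nu>: "\<nu> > 0" "\<And>j. r (n + j) powr p * (\<nu> * real j) \<le> 1" by blast
  define q where "q = (1 - \<theta>) / p"
  have q: "q > 0" using \<theta> p by (simp add: q_def)
  have exponent: "(1 - \<theta>) / (1 - 2 * \<theta>) = - q"
    unfolding q_def p_def by (metis minus_diff_eq minus_divide_right)
  show thesis
  proof
    show "C * (\<nu> / 2) powr (- q) > 0" using l(2) \<nu>(1) by simp
    fix k assume k: "k > 2 * n + 2"
    define j where "j = k - Suc n"
    have kj: "k = Suc (n + j)" using k by (simp add: j_def)
    \<comment> \<open>This is the reason for \<open>k > 2 * n + 2\<close>: the number of decay steps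
      is at least k/2, so the rate in j becomes a rate in k at the price of a constant
      factor.\<close>
    have j: "real k / 2 \<le> real j" "0 < real k" using k by (auto simp: j_def of_nat_diff)
    have pos: "0 < \<nu> / 2 * real k" using \<nu>(1) j by simp
    have "\<nu> / 2 * real k \<le> \<nu> * real j" using \<nu>(1) j mult_left_mono[of "real k / 2" "real j" \<nu>] by simp
    then have "r (n + j) powr p * (\<nu> / 2 * real k) \<le> r (n + j) powr p * (\<nu> * real j)"
      by (intro mult_left_mono) auto
    also have "\<dots> \<le> 1" by (rule \<nu>(2))
    finally have "r (n + j) powr p \<le> 1 / (\<nu> / 2 * real k)" using pos by (simp add: pos_le_divide_eq)
    then have "(r (n + j) powr p) powr q \<le> (1 / (\<nu> / 2 * real k)) powr q"
      using q by (intro powr_mono2) auto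
    moreover have "(r (n + j) powr p) powr q = r (n + j) powr (1 - \<theta>)"
      using p by (simp add: powr_powr q_def)
    moreover have "(1 / (\<nu> / 2 * real k)) powr q = (\<nu> / 2 * real k) powr (- q)"
      using pos by (simp add: powr_minus_divide powr_divide)
    moreover have "(\<nu> / 2 * real k) powr (- q) = (\<nu> / 2) powr (- q) * real k powr (- q)"
      by (rule powr_mult)
    ultimately have "r (n + j) powr (1 - \<theta>) \<le> (\<nu> / 2) powr (- q) * real k powr (- q)" by simp
    then have "C * r (n + j) powr (1 - \<theta>) \<le> C * ((\<nu> / 2) powr (- q) * real k powr (- q))"
      using l(2) by (intro mult_left_mono) auto
    then show "norm (x k - l) \<le> C * (\<nu> / 2) powr (- q) * real k powr ((1 - \<theta>) / (1 - 2 * \<theta>))"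
      using bound[of "n + j"] by (simp add: exponent kj mult.assoc)
  qed (rule l(1))
qed

section \<open>Lower semicontinuity and subgradients\<close>

text \<open>The centre satisfies y < f u trivially, so punctured and full neighbourhoods agree. The
  form with \<open>nhds\<close> composes with any convergent map, even one that attains its
  limit.\<close>

lemma lsc_iff_eventually:
  "lsc f \<longleftrightarrow> (\<forall>u. \<forall>y<f u. \<forall>\<^sub>F w in nhds u. y < f w)"
proof -
  have "ereal (f u) \<le> Liminf (at u) (\<lambda>w. ereal (f w)) \<longleftrightarrow> (\<forall>y<f u. \<forall>\<^sub>F w in nhds u. y < f w)" for u
  proof -
    have "ereal (f u) \<le> Liminf (at u) (\<lambda>w. ereal (f w))
      \<longleftrightarrow> (\<forall>y<ereal (f u). \<forall>\<^sub>F w in at u. y < ereal (f w))"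
      by (rule le_Liminf_iff)
    also have "\<dots> \<longleftrightarrow> (\<forall>y<f u. \<forall>\<^sub>F w in at u. y < f w)"
    proof safe
      fix y assume "\<forall>y<ereal (f u). \<forall>\<^sub>F w in at u. y < ereal (f w)" "y < f u"
      then show "\<forall>\<^sub>F w in at u. y < f w" by (auto dest!: spec[of _ "ereal y"])
    next
      fix y assume "\<forall>y<f u. \<forall>\<^sub>F w in at u. y < f w" "y < ereal (f u)"
      then show "\<forall>\<^sub>F w in at u. y < ereal (f w)" by (cases y) auto
    qed
    also have "\<dots> \<longleftrightarrow> (\<forall>y<f u. \<forall>\<^sub>F w in nhds u. y < f w)"
      by (auto simp: eventually_nhds_conv_at)
    finally show ?thesis .
  qed
  then show ?thesis unfolding lsc_def by blast
qed

lemma lsc_empirical_loss: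
  fixes xs :: "'n::finite \<Rightarrow> 'x"
  assumes "\<And>i. lsc (L (xs i) (ys i))"
  shows "lsc (empirical_loss L xs ys)"
  unfolding lsc_iff_eventually
proof safe
  fix u :: "real^'n" and y :: real
  assume y: "y < empirical_loss L xs ys u"
  \<comment> \<open>In an average every term may lose the full gap \<open>e\<close>.\<close>
  define e where "e = empirical_loss L xs ys u - y"
  have "\<forall>\<^sub>F w in nhds u. L (xs i) (ys i) (u $ i) - e < L (xs i) (ys i) (w $ i)" for i
  proof -
    have "((\<lambda>w. w $ i) \<longlongrightarrow> u $ i) (nhds u)"
      using tendsto_vec_nth[OF filterlim_ident] .
    moreover have "\<forall>\<^sub>F t in nhds (u $ i). L (xs i) (ys i) (u $ i) - e < L (xs i) (ys i) t"
      using assms[of i] y unfolding lsc_iff_eventually e_def by auto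
    ultimately show ?thesis by (rule eventually_compose_filterlim[rotated])
  qed
  then have "\<forall>\<^sub>F w in nhds u. \<forall>i. L (xs i) (ys i) (u $ i) - e < L (xs i) (ys i) (w $ i)"
    by (simp add: eventually_all_finite)
  then show "\<forall>\<^sub>F w in nhds u. y < empirical_loss L xs ys w"
  proof eventually_elim
    case (elim w)
    have "(\<Sum>i\<in>UNIV. L (xs i) (ys i) (u $ i) - e) < (\<Sum>i\<in>UNIV. L (xs i) (ys i) (w $ i))"
      using elim by (intro sum_strict_mono) auto
    then have "1 / real CARD('n) * (\<Sum>i\<in>UNIV. L (xs i) (ys i) (u $ i) - e)
      < empirical_loss L xs ys w"
      unfolding empirical_loss_def by (intro mult_strict_left_mono) auto
    moreover have "1 / real CARD('n) * (\<Sum>i\<in>UNIV. L (xs i) (ys i) (u $ i) - e)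
      = empirical_loss L xs ys u - e"
      by (simp add: empirical_loss_def sum_subtractf right_diff_distrib)
    ultimately show ?case by (simp add: e_def)
  qed
qed

text \<open>Such a \<open>v\<close> is a proximal subgradient: the difference quotient is at least
  -M times the distance, which tends to 0. It is thus regular, and constant sequences make it
  limiting.\<close>

lemma limiting_subdiff_quadratic_minorant:
  fixes f :: "'a::euclidean_space \<Rightarrow> real"
  assumes "\<And>w. f u + v \<bullet> (w - u) - M * (norm (w - u))\<^sup>2 \<le> f w"
  shows "v \<in> limiting_subdiff f u"
proof -
  have "0 \<le> Liminf (at u) (\<lambda>w. ereal ((f w - f u - v \<bullet> (w - u)) / norm (w - u)))"
  proof -
    have "((\<lambda>w. - M * norm (w - u)) \<longlongrightarrow> - M * norm (u - u)) (at u)"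
      by (intro tendsto_intros)
    then have "((\<lambda>w. ereal (- M * norm (w - u))) \<longlongrightarrow> ereal (- M * norm (u - u))) (at u)"
      by (simp only: lim_ereal)
    then have "Liminf (at u) (\<lambda>w. ereal (- M * norm (w - u))) = ereal (- M * norm (u - u))"
      by (intro lim_imp_Liminf) simp_all
    moreover have "Liminf (at u) (\<lambda>w. ereal (- M * norm (w - u)))
      \<le> Liminf (at u) (\<lambda>w. ereal ((f w - f u - v \<bullet> (w - u)) / norm (w - u)))"
    proof (rule Liminf_mono)
      have "- M * norm (w - u) \<le> (f w - f u - v \<bullet> (w - u)) / norm (w - u)" if "w \<noteq> u" for w
        using assms[of w] that by (simp add: pos_le_divide_eq power2_eq_square algebra_simps)
      then show "\<forall>\<^sub>F w in at u. ereal (- M * norm (w - u))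
        \<le> ereal ((f w - f u - v \<bullet> (w - u)) / norm (w - u))"
        by (auto simp: eventually_at_filter)
    qed
    ultimately show ?thesis by (simp add: zero_ereal_def)
  qed
  then have "v \<in> regular_subdiff f u" by (simp add: regular_subdiff_def)
  then show ?thesis unfolding limiting_subdiff_def
    by (intro CollectI exI[of _ "\<lambda>_. u"] exI[of _ "\<lambda>_. v"]) auto
qed

section \<open>The Kurdyka-Lojasiewicz inequality and the limit set\<close>

lemma ext_dist_less_iff: "ext_dist u S < ereal e \<longleftrightarrow> (\<exists>v\<in>S. dist u v < e)"
  by (simp add: ext_dist_def INF_less_iff)

text \<open>A single subgradient bounds the distance to the subdifferential from above, which
  removes extended reals from later arguments. The sign condition on the derivative lets it be
  multiplied into that bound.\<close>

lemma KL_propertyE: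
  fixes f :: "'a::euclidean_space \<Rightarrow> real"
  assumes "KL_property f S \<phi>" and val: "f ` S = {l}"
  obtains \<epsilon> \<eta> where "\<epsilon> > 0" "\<eta> > 0"
    "\<And>u v s. \<lbrakk>s \<in> S; dist u s < \<epsilon>; l < f u; f u < l + \<eta>; v \<in> limiting_subdiff f u;
       0 \<le> deriv \<phi> (f u - l)\<rbrakk> \<Longrightarrow> 1 \<le> deriv \<phi> (f u - l) * norm v"
proof -
  have l: "value_on f S = l" by (simp add: value_on_def val)
  obtain \<epsilon> \<eta> where pos: "\<epsilon> > 0" "\<eta> > 0"
    and KL: "\<And>u. ext_dist u S < ereal \<epsilon> \<Longrightarrow> l < f u \<Longrightarrow> f u < l + \<eta>
      \<Longrightarrow> 1 \<le> ereal (deriv \<phi> (f u - l)) * ext_dist 0 (limiting_subdiff f u)"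
    using assms(1) unfolding KL_property_def l by blast
  have "1 \<le> deriv \<phi> (f u - l) * norm v"
    if "s \<in> S" "dist u s < \<epsilon>" "l < f u" "f u < l + \<eta>" "v \<in> limiting_subdiff f u"
      "0 \<le> deriv \<phi> (f u - l)" for u v s
  proof -
    have "1 \<le> ereal (deriv \<phi> (f u - l)) * ext_dist 0 (limiting_subdiff f u)"
      using that by (intro KL) (auto simp: ext_dist_less_iff)
    also have "ext_dist 0 (limiting_subdiff f u) \<le> ereal (norm v)"
      unfolding ext_dist_def using INF_lower[OF that(5), of "\<lambda>v. ereal (dist 0 v)"] by simp
    then have "ereal (deriv \<phi> (f u - l)) * ext_dist 0 (limiting_subdiff f u)
      \<le> ereal (deriv \<phi> (f u - l)) * ereal (norm v)"
      using that(6) by (intro ereal_mult_left_mono) auto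
    finally show ?thesis by simp
  qed
  with pos that show thesis by blast
qed

text \<open>A subsequence staying away from the limit set would, by compactness, have a limit point
  of its own, which belongs to that set.\<close>

lemma eventually_near_subseq_limits:
  fixes x :: "nat \<Rightarrow> 'a::heine_borel"
  assumes "bounded (range x)" "\<epsilon> > 0"
  shows "\<forall>\<^sub>F k in sequentially. \<exists>l\<in>subseq_limits x. dist (x k) l < \<epsilon>"
proof (rule ccontr)
  assume "\<not> ?thesis"
  then obtain r :: "nat \<Rightarrow> nat" where r: "strict_mono r"
    and far: "\<And>n. \<not> (\<exists>l\<in>subseq_limits x. dist (x (r n)) l < \<epsilon>)"
    using not_eventually_sequentiallyD by blast
  have "bounded (range (x \<circ> r))"
    using assms(1) by (rule bounded_subset) auto
  then obtain l q where q: "strict_mono q" "((x \<circ> r) \<circ> q) \<longlonglongrightarrow> l"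
    using bounded_imp_convergent_subsequence by blast
  then have "l \<in> subseq_limits x"
    unfolding subseq_limits_def using r by (auto simp: o_assoc intro!: exI[of _ "r \<circ> q"] strict_mono_o)
  moreover obtain j where "dist (x (r (q j))) l < \<epsilon>"
    using q(2) assms(2) unfolding lim_sequentially by fastforce
  ultimately show False using far by blast
qed

lemma subseq_limits_nonempty:
  fixes x :: "nat \<Rightarrow> 'a::heine_borel"
  assumes "bounded (range x)"
  shows "subseq_limits x \<noteq> {}"
  using eventually_near_subseq_limits[OF assms, of 1] by (force simp: eventually_sequentially)

section \<open>The splitting method\<close>

locale splitting_method =
  fixes F :: "real^'n::finite \<Rightarrow> real" and A :: "real^'n^'n" and lam \<rho> :: real
    and \<alpha> c \<gamma> :: "nat \<Rightarrow> real^'n"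
  assumes F_nonneg: "0 \<le> F a"
    and F_lsc: "lsc F"
    and lam: "0 < lam"
    and rho: "0 < \<rho>"
    and A_sym: "transpose A = A"
    and A_pos: "strictly_pos_def A"
    and rho_large: "\<rho> > 4 * lam * onorm ((*v) (matrix_inv A))"
    and iterates: "splitting_iterates F A lam \<rho> \<alpha> c \<gamma>"
begin

abbreviation "Lag \<equiv> aug_lagrangian F A lam \<rho>"
abbreviation "u k \<equiv> (\<alpha> k, c k, \<gamma> k)"

definition "inv_norm = onorm ((*v) (matrix_inv A))"

lemma alpha_min: "Lag (\<alpha> (Suc k), c k, \<gamma> k) \<le> Lag (a, c k, \<gamma> k)"
  and c_min: "Lag (\<alpha> (Suc k), c (Suc k), \<gamma> k) \<le> Lag (\<alpha> (Suc k), b, \<gamma> k)"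
  and gamma_step: "\<gamma> (Suc k) = \<gamma> k + \<rho> *\<^sub>R (\<alpha> (Suc k) - A *v c (Suc k))"
  using iterates unfolding splitting_iterates_def is_arg_min_def by (simp_all add: not_less)

section \<open>Linear algebra of the kernel matrix\<close>

lemma A_inner: "x \<bullet> (A *v y) = (A *v x) \<bullet> y"
  using dot_lmul_matrix[of x A y] A_sym by (metis transpose_matrix_vector)

lemma A_nonneg: "0 \<le> x \<bullet> (A *v x)"
  using A_pos unfolding strictly_pos_def_def by (cases "x = 0") (auto simp: less_imp_le)

lemma A_inj: "A *v x = 0 \<Longrightarrow> x = 0"
  using A_pos unfolding strictly_pos_def_def by (metis inner_zero_right less_irrefl)

lemma A_inv: "A *v (matrix_inv A *v x) = x" "matrix_inv A *v (A *v x) = x"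
proof -
  have inv: "invertible A"
    unfolding invertible_left_inverse matrix_left_invertible_ker using A_inj by blast
  then have "A ** matrix_inv A = mat 1 \<and> matrix_inv A ** A = mat 1"
    unfolding matrix_inv_def invertible_def by (rule someI_ex)
  then show "A *v (matrix_inv A *v x) = x" "matrix_inv A *v (A *v x) = x"
    by (simp_all add: matrix_vector_mul_assoc)
qed

lemma norm_le_inv_norm: "norm x \<le> inv_norm * norm (A *v x)"
  unfolding inv_norm_def using onorm[OF matrix_vector_mul_bounded_linear, of "matrix_inv A" "A *v x"]
  by (simp add: A_inv)

lemma inv_norm_pos: "0 < inv_norm"
proof -
  obtain x :: "real^'n" where x: "norm x = 1" using vector_choose_size[of 1] by auto
  then have "0 < inv_norm * norm (A *v x)" using norm_le_inv_norm[of x] by linarith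
  then show ?thesis by (metis less_eq_real_def linorder_not_le mult_nonpos_nonneg norm_ge_zero)
qed

lemma rho_large': "4 * lam * inv_norm < \<rho>"
  using rho_large by (simp add: inv_norm_def)

text \<open>The least eigenvalue of \<open>A\<close> is 1 / \<open>inv_norm\<close>. Instead of
  diagonalising, the form is evaluated at \<open>inv_norm\<close> times x minus z, where A z = x,
  and its nonnegativity is combined with Cauchy-Schwarz for x and z.\<close>

lemma A_coercive: "(norm x)\<^sup>2 \<le> inv_norm * (x \<bullet> (A *v x))"
proof -
  define z where "z = matrix_inv A *v x"
  have Az: "A *v z = x" by (simp add: z_def A_inv)
  have "x \<bullet> z \<le> norm x * norm z" by (rule norm_cauchy_schwarz)
  also have "\<dots> \<le> norm x * (inv_norm * norm x)"
    using norm_le_inv_norm[of z] by (intro mult_left_mono) (auto simp: Az)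
  finally have xz: "x \<bullet> z \<le> inv_norm * (norm x)\<^sup>2" by (simp add: power2_eq_square ac_simps)
  have "0 \<le> (inv_norm *\<^sub>R x - z) \<bullet> (A *v (inv_norm *\<^sub>R x - z))" by (rule A_nonneg)
  also have "\<dots> = inv_norm\<^sup>2 * (x \<bullet> (A *v x)) - 2 * inv_norm * (norm x)\<^sup>2 + x \<bullet> z"
    using A_inner[of z x]
    by (simp add: matrix_vector_mult_diff_distrib matrix_vector_mult_scaleR Az inner_diff
        inner_commute power2_norm_eq_inner algebra_simps)
      (simp add: power2_eq_square)
  finally have "inv_norm * (norm x)\<^sup>2 \<le> inv_norm * (inv_norm * (x \<bullet> (A *v x)))"
    using xz by (simp add: power2_eq_square algebra_simps)
  then show ?thesis using inv_norm_pos by simp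
qed

section \<open>Optimality in the coefficients and sufficient decrease\<close>

text \<open>Taylor's formula is exact here because the Lagrangian is quadratic in \<open>c\<close>.
  The linear term serves the optimality condition, the quadratic one measures the gain of the
  c-step.\<close>

lemma Lag_expand_c:
  "Lag (a, b + d, g) = Lag (a, b, g)
     + d \<bullet> ((2 * lam) *\<^sub>R (A *v b) - A *v g - \<rho> *\<^sub>R (A *v (a - A *v b)))
     + (lam * (d \<bullet> (A *v d)) + \<rho> / 2 * (norm (A *v d))\<^sup>2)"
proof -
  have 1: "(b + d) \<bullet> (A *v (b + d)) = b \<bullet> (A *v b) + 2 * (d \<bullet> (A *v b)) + d \<bullet> (A *v d)"
    using A_inner[of b d]
    by (simp add: matrix_vector_right_distrib inner_add inner_commute)
  have 2: "a - A *v (b + d) = (a - A *v b) - A *v d"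
    by (simp add: matrix_vector_right_distrib)
  have 3: "(norm ((a - A *v b) - A *v d))\<^sup>2
     = (norm (a - A *v b))\<^sup>2 - 2 * (d \<bullet> (A *v (a - A *v b))) + (norm (A *v d))\<^sup>2"
    unfolding power2_norm_eq_inner A_inner[of d "a - A *v b"]
    by (simp add: inner_diff inner_commute algebra_simps)
  show ?thesis unfolding aug_lagrangian_def prod.case 1 2 3
    using A_inner[of d g] by (simp add: inner_diff inner_commute algebra_simps)
qed

text \<open>The gradient at the minimiser \<open>c k\<close> vanishes; cancelling the injective
  \<open>A\<close> from it leaves exactly the multiplier update. The value \<open>\<gamma> 0\<close>
  is free, hence the assumption.\<close>

lemma gamma_eq:
  assumes "k > 0"
  shows "\<gamma> k = (2 * lam) *\<^sub>R c k"
proof -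
  obtain j where k: "k = Suc j" using assms gr0_implies_Suc by blast
  define a b g where "a = \<alpha> k" and "b = c k" and "g = \<gamma> j"
  define w where "w = (2 * lam) *\<^sub>R (A *v b) - A *v g - \<rho> *\<^sub>R (A *v (a - A *v b))"
  define q where "q = lam * (w \<bullet> (A *v w)) + \<rho> / 2 * (norm (A *v w))\<^sup>2"
  have q: "0 \<le> q" using A_nonneg[of w] lam rho by (simp add: q_def)
  have min: "0 \<le> t * (w \<bullet> w) + t\<^sup>2 * q" for t
  proof -
    have "Lag (a, b + t *\<^sub>R w, g) = Lag (a, b, g) + t * (w \<bullet> w) + t\<^sup>2 * q"
      unfolding Lag_expand_c w_def[symmetric]
      by (simp add: q_def matrix_vector_mult_scaleR power_mult_distrib algebra_simps
          power2_eq_square[of t])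
    then show ?thesis using c_min[of j "b + t *\<^sub>R w"] by (simp add: a_def b_def g_def k)
  qed
  have "w \<bullet> w \<le> 0"
  proof (rule ccontr)
    assume "\<not> w \<bullet> w \<le> 0"
    \<comment> \<open>A small step against the gradient \<open>w\<close>; q + 1 instead of q avoids
      a zero denominator and leaves half of the linear decrease.\<close>
    define t where "t = - (w \<bullet> w) / (2 * (q + 1))"
    have t: "t < 0" "t * (q + 1) = - (w \<bullet> w) / 2"
      using q \<open>\<not> w \<bullet> w \<le> 0\<close> by (auto simp: t_def divide_neg_pos field_simps)
    have "0 \<le> t * (w \<bullet> w) + t\<^sup>2 * q" by (rule min)
    also have "\<dots> \<le> t * (w \<bullet> w + t * (q + 1))"
      by (simp add: algebra_simps power2_eq_square)
    also have "\<dots> = t * ((w \<bullet> w) / 2)" unfolding t(2) by simp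
    also have "\<dots> < 0"
      using t(1) \<open>\<not> w \<bullet> w \<le> 0\<close> by (intro mult_neg_pos) auto
    finally show False by simp
  qed
  then have "w = 0" by (metis inner_eq_zero_iff inner_ge_zero order_antisym)
  moreover have "w = A *v ((2 * lam) *\<^sub>R b - (g + \<rho> *\<^sub>R (a - A *v b)))"
    by (simp add: w_def matrix_vector_mult_diff_distrib matrix_vector_right_distrib
        matrix_vector_mult_scaleR)
  ultimately have "(2 * lam) *\<^sub>R b - (g + \<rho> *\<^sub>R (a - A *v b)) = 0" by (metis A_inj)
  then show ?thesis by (simp add: gamma_step a_def b_def g_def k)
qed

text \<open>Gain of the c-step, through |A d| \<ge> |d| / \<open>inv_norm\<close>, minus the cost of
  the multiplier step, where the change of \<gamma> is 2 \<open>lam\<close> times that of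
  \<open>c\<close>.\<close>

definition "decrease = \<rho> / (2 * inv_norm\<^sup>2) - 4 * lam\<^sup>2 / \<rho>"

text \<open>Positivity amounts to \<rho>^2 > 8 (lam * inv_norm)^2, while the assumption provides the
  constant 16.\<close>

lemma decrease_pos: "0 < decrease"
proof -
  have "4 * lam\<^sup>2 * (2 * inv_norm\<^sup>2) \<le> (4 * lam * inv_norm) * (4 * lam * inv_norm)"
    using lam by (simp add: power2_eq_square)
  also have "\<dots> < \<rho> * \<rho>"
    using rho_large' lam rho inv_norm_pos by (intro mult_strict_mono) auto
  finally show ?thesis
    using rho inv_norm_pos by (simp add: decrease_def field_simps power2_eq_square)
qed

lemma descent:
  assumes k: "k > 0"
  shows "Lag (u (Suc k)) + decrease * (norm (c (Suc k) - c k))\<^sup>2 \<le> Lag (u k)"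
proof -
  define a b g where "a = \<alpha> (Suc k)" and "b = c (Suc k)" and "g = \<gamma> (Suc k)"
  define d where "d = c k - b"
  \<comment> \<open>The gradient of the c-subproblem at its minimiser, so that expanding from
    \<open>b\<close> to \<open>c k\<close> leaves only the quadratic term.\<close>
  have opt: "(2 * lam) *\<^sub>R (A *v b) - A *v \<gamma> k - \<rho> *\<^sub>R (A *v (a - A *v b)) = 0"
    using arg_cong[OF gamma_step[of k], of "(*v) A"]
    by (simp add: gamma_eq[of "Suc k"] a_def b_def matrix_vector_mult_scaleR
        matrix_vector_right_distrib algebra_simps)
  have "Lag (a, b + d, \<gamma> k)
    = Lag (a, b, \<gamma> k) + (lam * (d \<bullet> (A *v d)) + \<rho> / 2 * (norm (A *v d))\<^sup>2)"
    unfolding Lag_expand_c opt by simp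
  moreover have "\<rho> / (2 * inv_norm\<^sup>2) * (norm d)\<^sup>2 \<le> \<rho> / 2 * (norm (A *v d))\<^sup>2"
  proof -
    have "(norm d)\<^sup>2 \<le> (inv_norm * norm (A *v d))\<^sup>2"
      by (intro power_mono norm_le_inv_norm) auto
    then show ?thesis using rho inv_norm_pos by (simp add: power_mult_distrib field_simps)
  qed
  moreover have "0 \<le> lam * (d \<bullet> (A *v d))" using lam A_nonneg by simp
  \<comment> \<open>The multiplier step is an ascent step and raises the value; the residual is
    itself a multiple of \<open>d\<close>.\<close>
  moreover have "Lag (a, b, g) = Lag (a, b, \<gamma> k) + 4 * lam\<^sup>2 / \<rho> * (norm d)\<^sup>2"
  proof -
    have "\<rho> *\<^sub>R (a - A *v b) = - (2 * lam) *\<^sub>R d" "g = \<gamma> k - (2 * lam) *\<^sub>R d"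
      using gamma_step[of k] gamma_eq[OF k] gamma_eq[of "Suc k"]
      by (simp_all add: a_def b_def g_def d_def algebra_simps)
    moreover have "a - A *v b = (1 / \<rho>) *\<^sub>R (\<rho> *\<^sub>R (a - A *v b))" using rho by simp
    ultimately have "g = \<gamma> k - (2 * lam) *\<^sub>R d" "a - A *v b = - (2 * lam / \<rho>) *\<^sub>R d"
      by auto
    then have g: "g = \<gamma> k - (2 * lam) *\<^sub>R d"
      and d: "d \<bullet> (a - A *v b) = - (2 * lam / \<rho>) * (norm d)\<^sup>2"
      by (simp_all add: power2_norm_eq_inner)
    have "Lag (a, b, g) = Lag (a, b, \<gamma> k) - 2 * lam * (d \<bullet> (a - A *v b))"
      unfolding g by (simp add: aug_lagrangian_def inner_diff_left)
    then show ?thesis unfolding d by (simp add: power2_eq_square)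
  qed
  moreover have "Lag (a, b + d, \<gamma> k) \<le> Lag (u k)"
    using alpha_min[of k "\<alpha> k"] by (simp add: a_def d_def)
  ultimately have "Lag (a, b, g) + decrease * (norm d)\<^sup>2 \<le> Lag (u k)"
    unfolding decrease_def left_diff_distrib by linarith
  then show ?thesis by (simp add: a_def b_def g_def d_def norm_minus_commute)
qed

section \<open>Lower bound, boundedness and convergence of the values\<close>

lemma Lag_eq: "Lag (a, b, g) = F a + aug_lagrangian (\<lambda>_. 0) A lam \<rho> (a, b, g)"
  by (simp add: aug_lagrangian_def)

lemma tendsto_A [tendsto_intros]: "(f \<longlongrightarrow> y) net \<Longrightarrow> ((\<lambda>x. A *v f x) \<longlongrightarrow> A *v y) net"
  by (rule bounded_linear.tendsto[OF matrix_vector_mul_bounded_linear])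

lemma tendsto_smooth_part:
  assumes "(fa \<longlongrightarrow> a) net" "(fb \<longlongrightarrow> b) net" "(fg \<longlongrightarrow> g) net"
  shows "((\<lambda>x. aug_lagrangian (\<lambda>_. 0) A lam \<rho> (fa x, fb x, fg x))
    \<longlongrightarrow> aug_lagrangian (\<lambda>_. 0) A lam \<rho> (a, b, g)) net"
  unfolding aug_lagrangian_def prod.case by (intro tendsto_intros assms)

text \<open>With \<gamma> = 2 \<open>lam\<close> c the multiplier term becomes a cross term of
  \<open>c\<close> and the residual. Half of the coercive form in \<open>c\<close> absorbs it, at a
  cost of 2 * lam * inv_norm on the squared residual; what remains of the penalty is positive
  exactly when \<rho> > 4 * lam * inv_norm.\<close>

lemma Lag_lower:
  assumes k: "k > 0"
  shows "lam / (2 * inv_norm) * (norm (c k))\<^sup>2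
    + (\<rho> / 2 - 2 * lam * inv_norm) * (norm (\<alpha> k - A *v c k))\<^sup>2 \<le> Lag (u k)"
proof -
  define p where "p = \<alpha> k - A *v c k"
  define X where "X = lam / (2 * inv_norm) * (norm (c k))\<^sup>2"
  have "2 * X \<le> lam * (c k \<bullet> (A *v c k))"
    using A_coercive[of "c k"] lam inv_norm_pos by (simp add: X_def field_simps)
  moreover have "- (2 * lam * (c k \<bullet> p)) \<le> X + 2 * lam * inv_norm * (norm p)\<^sup>2"
  proof -
    have "0 \<le> (norm (c k + (2 * inv_norm) *\<^sub>R p))\<^sup>2" by simp
    also have "\<dots> = (norm (c k))\<^sup>2 + 4 * inv_norm * (c k \<bullet> p) + 4 * inv_norm\<^sup>2 * (norm p)\<^sup>2"
      unfolding power2_norm_eq_inner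
      by (simp add: inner_add inner_commute power2_eq_square algebra_simps)
    finally have "0 \<le> lam / (2 * inv_norm) * \<dots>" using lam inv_norm_pos by simp
    also have "\<dots> = X + 2 * lam * (c k \<bullet> p) + 2 * lam * inv_norm * (norm p)\<^sup>2"
      using inv_norm_pos by (simp add: X_def field_simps power2_eq_square)
    finally show ?thesis by simp
  qed
  moreover have "Lag (u k) = F (\<alpha> k) + lam * (c k \<bullet> (A *v c k)) + 2 * lam * (c k \<bullet> p) + \<rho> / 2 * (norm p)\<^sup>2"
    unfolding aug_lagrangian_def prod.case gamma_eq[OF k] p_def[symmetric] by simp
  ultimately show ?thesis
    using F_nonneg[of "\<alpha> k"] unfolding p_def[symmetric] X_def[symmetric] left_diff_distrib by linarith
qed

lemma Lag_decreasing: "k > 0 \<Longrightarrow> Lag (u (Suc k)) \<le> Lag (u k)"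
  using descent[of k] decrease_pos
  by (smt (verit, best) mult_nonneg_nonneg zero_le_power2)

lemma Lag_nonneg: "k > 0 \<Longrightarrow> 0 \<le> Lag (u k)"
proof -
  assume k: "k > 0"
  have "0 \<le> lam / (2 * inv_norm) * (norm (c k))\<^sup>2" using lam inv_norm_pos by simp
  moreover have "0 \<le> (\<rho> / 2 - 2 * lam * inv_norm) * (norm (\<alpha> k - A *v c k))\<^sup>2"
    using rho_large' by (intro mult_nonneg_nonneg) auto
  ultimately show ?thesis using Lag_lower[OF k] by linarith
qed

lemma Lag_limit:
  obtains l where "(\<lambda>k. Lag (u k)) \<longlonglongrightarrow> l" "\<And>k. k > 0 \<Longrightarrow> l \<le> Lag (u k)"
proof -
  have dec: "decseq (\<lambda>k. Lag (u (Suc k)))"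
    by (intro decseq_SucI Lag_decreasing) simp
  have lower: "\<forall>k. 0 \<le> Lag (u (Suc k))" using Lag_nonneg by simp
  obtain l where l: "(\<lambda>k. Lag (u (Suc k))) \<longlonglongrightarrow> l" "\<And>k. l \<le> Lag (u (Suc k))"
    using decseq_convergent[OF dec lower] by blast
  show thesis
  proof
    show "(\<lambda>k. Lag (u k)) \<longlonglongrightarrow> l" using l(1) by (rule LIMSEQ_imp_Suc)
    show "l \<le> Lag (u k)" if "k > 0" for k using l(2) that by (metis gr0_implies_Suc)
  qed
qed

text \<open>From index 1 on the triple is a linear image of residual and coefficients, and the
  decreasing values bound both through \<open>Lag_lower\<close>. Index 0 is added by hand.\<close>

lemma bounded_iterates: "bounded (range u)"
proof -
  have bound_sq: "norm v \<le> sqrt (M / q)" if "q * (norm v)\<^sup>2 \<le> M" "0 < q" for v :: "real^'n" and q M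
    using that by (intro real_le_rsqrt) (simp add: field_simps)
  define p where "p k = \<alpha> k - A *v c k" for k
  define M where "M = Lag (u 1)"
  have le: "Lag (u (Suc k)) \<le> M" for k
  proof (induction k)
    case (Suc k)
    then show ?case using Lag_decreasing[of "Suc k"] by simp
  qed (simp add: M_def)
  have parts: "lam / (2 * inv_norm) * (norm (c (Suc k)))\<^sup>2 \<le> M"
    "(\<rho> / 2 - 2 * lam * inv_norm) * (norm (p (Suc k)))\<^sup>2 \<le> M" for k
  proof -
    have "0 \<le> lam / (2 * inv_norm) * (norm (c (Suc k)))\<^sup>2" using lam inv_norm_pos by simp
    moreover have "0 \<le> (\<rho> / 2 - 2 * lam * inv_norm) * (norm (p (Suc k)))\<^sup>2"
      using rho_large' by (intro mult_nonneg_nonneg) auto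
    ultimately show "lam / (2 * inv_norm) * (norm (c (Suc k)))\<^sup>2 \<le> M"
      "(\<rho> / 2 - 2 * lam * inv_norm) * (norm (p (Suc k)))\<^sup>2 \<le> M"
      using Lag_lower[of "Suc k"] le[of k] unfolding p_def by linarith+
  qed
  have c: "norm (c (Suc k)) \<le> sqrt (M / (lam / (2 * inv_norm)))" for k
    using lam inv_norm_pos by (intro bound_sq parts) auto
  have p: "norm (p (Suc k)) \<le> sqrt (M / (\<rho> / 2 - 2 * lam * inv_norm))" for k
    using rho_large' by (intro bound_sq parts) auto
  have bc: "bounded (range (\<lambda>k. c (Suc k)))" and bp: "bounded (range (\<lambda>k. p (Suc k)))"
    using c p by (auto simp: bounded_iff)
  have "bounded ((\<lambda>(p, c). (p + A *v c, c, (2 * lam) *\<^sub>R c)) `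
    (range (\<lambda>k. p (Suc k)) \<times> range (\<lambda>k. c (Suc k))))"
  proof (rule bounded_linear_image)
    show "bounded_linear (\<lambda>(p, c). (p + A *v c, c, (2 * lam) *\<^sub>R c))"
      unfolding linear_conv_bounded_linear[symmetric] case_prod_beta
      by (auto intro!: linearI simp: matrix_vector_right_distrib matrix_vector_mult_scaleR algebra_simps)
  qed (intro bounded_Times bc bp)
  moreover have "range (\<lambda>k. u (Suc k)) \<subseteq> (\<lambda>(p, c). (p + A *v c, c, (2 * lam) *\<^sub>R c)) `
    (range (\<lambda>k. p (Suc k)) \<times> range (\<lambda>k. c (Suc k)))"
  proof (rule image_subsetI)
    fix k
    have "u (Suc k) = (\<lambda>(p, c). (p + A *v c, c, (2 * lam) *\<^sub>R c)) (p (Suc k), c (Suc k))"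
      by (simp add: p_def gamma_eq)
    then show "u (Suc k) \<in> (\<lambda>(p, c). (p + A *v c, c, (2 * lam) *\<^sub>R c)) `
        (range (\<lambda>k. p (Suc k)) \<times> range (\<lambda>k. c (Suc k)))"
      by (rule image_eqI) simp
  qed
  ultimately have "bounded (range (\<lambda>k. u (Suc k)))" using bounded_subset by blast
  then have "bounded (insert (u 0) (range (\<lambda>k. u (Suc k))))" by simp
  moreover have "range u \<subseteq> insert (u 0) (range (\<lambda>k. u (Suc k)))"
  proof (rule image_subsetI)
    show "u k \<in> insert (u 0) (range (\<lambda>k. u (Suc k)))" for k by (cases k) auto
  qed
  ultimately show ?thesis using bounded_subset by blast
qed

section \<open>Vanishing steps and the value on the limit set\<close>

lemma c_step_tendsto_0: "(\<lambda>k. c (Suc k) - c k) \<longlonglongrightarrow> 0"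
proof -
  obtain l where l: "(\<lambda>k. Lag (u k)) \<longlonglongrightarrow> l" using Lag_limit by blast
  have "(\<lambda>k. (Lag (u k) - Lag (u (Suc k))) / decrease) \<longlonglongrightarrow> (l - l) / decrease"
    using decrease_pos by (intro tendsto_intros l LIMSEQ_Suc[OF l]) auto
  then have lim: "(\<lambda>k. (Lag (u k) - Lag (u (Suc k))) / decrease) \<longlonglongrightarrow> 0" by simp
  have "(\<lambda>k. (norm (c (Suc k) - c k))\<^sup>2) \<longlonglongrightarrow> 0"
  proof (rule tendsto_sandwich[OF _ _ tendsto_const lim])
    show "\<forall>\<^sub>F k in sequentially. (norm (c (Suc k) - c k))\<^sup>2 \<le> (Lag (u k) - Lag (u (Suc k))) / decrease"
      using eventually_gt_at_top[of 0]
    proof eventually_elim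
      case (elim k)
      then show ?case using descent[of k] decrease_pos by (simp add: field_simps)
    qed
  qed simp
  from tendsto_real_sqrt[OF this] have "(\<lambda>k. norm (c (Suc k) - c k)) \<longlonglongrightarrow> 0"
    by simp
  then show ?thesis by (rule tendsto_norm_zero_cancel)
qed

text \<open>Lower semicontinuity alone does not give \<open>F (\<alpha> k) \<longrightarrow> F a\<close> along the subsequence; the
  missing upper bound comes from comparing the minimiser \<open>\<alpha> k\<close> with \<open>a\<close>.\<close>

lemma Lag_subseq_limit:
  assumes lim: "(\<lambda>k. Lag (u k)) \<longlonglongrightarrow> l" and mem: "(a, b, g) \<in> subseq_limits u"
  shows "Lag (a, b, g) = l"
proof -
  obtain r where r: "strict_mono r" and ur: "(u \<circ> r) \<longlonglongrightarrow> (a, b, g)"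
    using mem unfolding subseq_limits_def by blast
  \<comment> \<open>Index of the preceding iterate, whose \<open>c\<close> and
    \<open>\<gamma>\<close> enter the \<alpha>-subproblem. The offset 2 keeps it positive, so that
    \<open>gamma_eq\<close> applies there as well.\<close>
  define q where "q j = r (j + 2) - 1" for j
  have q: "r (j + 2) = Suc (q j)" "q j > 0" for j
    using seq_suble[OF r, of "j + 2"] by (auto simp: q_def)
  have "strict_mono q"
    unfolding strict_mono_Suc_iff q_def using r
    by (metis add_Suc diff_less_mono le_add2 one_le_numeral order_trans seq_suble strict_mono_Suc_iff)
  then have q_top: "filterlim q sequentially sequentially" by (rule filterlim_subseq)
  have "(\<lambda>j. u (Suc (q j))) \<longlonglongrightarrow> (a, b, g)"
    using LIMSEQ_ignore_initial_segment[OF ur, of 2] q(1) by simp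
  note this[THEN tendsto_fst] this[THEN tendsto_snd, THEN tendsto_fst] this[THEN tendsto_snd, THEN tendsto_snd]
  then have al: "(\<lambda>j. \<alpha> (Suc (q j))) \<longlonglongrightarrow> a" and cs: "(\<lambda>j. c (Suc (q j))) \<longlonglongrightarrow> b"
    and gs: "(\<lambda>j. \<gamma> (Suc (q j))) \<longlonglongrightarrow> g" by simp_all
  have step: "(\<lambda>j. c (Suc (q j)) - c (q j)) \<longlonglongrightarrow> 0"
    using filterlim_compose[OF c_step_tendsto_0 q_top] .
  \<comment> \<open>Since steps vanish, the preceding iterates share the limit; this makes the
    smooth parts in the comparison with \<open>a\<close> cancel in the limit.\<close>
  have c0: "(\<lambda>j. c (q j)) \<longlonglongrightarrow> b"
    using tendsto_diff[OF cs step] by simp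
  have "(\<lambda>j. \<gamma> (Suc (q j)) - (2 * lam) *\<^sub>R (c (Suc (q j)) - c (q j))) \<longlonglongrightarrow> g - (2 * lam) *\<^sub>R 0"
    by (intro tendsto_intros gs step)
  then have g0: "(\<lambda>j. \<gamma> (q j)) \<longlonglongrightarrow> g"
    using q(2) by (simp add: gamma_eq algebra_simps)
  define H where "H = aug_lagrangian (\<lambda>_. 0) A lam \<rho>"
  have "(\<lambda>j. F a + (H (a, c (q j), \<gamma> (q j)) - H (\<alpha> (Suc (q j)), c (q j), \<gamma> (q j))))
    \<longlonglongrightarrow> F a + (H (a, b, g) - H (a, b, g))"
    unfolding H_def by (intro tendsto_intros tendsto_smooth_part al c0 g0)
  then have ub_lim: "(\<lambda>j. F a + (H (a, c (q j), \<gamma> (q j)) - H (\<alpha> (Suc (q j)), c (q j), \<gamma> (q j)))) \<longlonglongrightarrow> F a"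
    by simp
  have ub: "F (\<alpha> (Suc (q j))) \<le> F a + (H (a, c (q j), \<gamma> (q j)) - H (\<alpha> (Suc (q j)), c (q j), \<gamma> (q j)))" for j
    using alpha_min[of "q j" a] by (simp add: Lag_eq H_def)
  have "(\<lambda>j. F (\<alpha> (Suc (q j)))) \<longlonglongrightarrow> F a"
  proof (rule order_tendstoI)
    fix y assume "y < F a"
    then have "\<forall>\<^sub>F w in nhds a. y < F w" using F_lsc by (simp add: lsc_iff_eventually)
    then show "\<forall>\<^sub>F j in sequentially. y < F (\<alpha> (Suc (q j)))"
      using al by (rule eventually_compose_filterlim)
  next
    fix y assume "F a < y"
    from order_tendstoD(2)[OF ub_lim this] show "\<forall>\<^sub>F j in sequentially. F (\<alpha> (Suc (q j))) < y"
      by eventually_elim (use ub le_less_trans in blast)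
  qed
  moreover have "(\<lambda>j. H (\<alpha> (Suc (q j)), c (Suc (q j)), \<gamma> (Suc (q j)))) \<longlonglongrightarrow> H (a, b, g)"
    unfolding H_def by (intro tendsto_smooth_part al cs gs)
  ultimately have "(\<lambda>j. Lag (u (Suc (q j)))) \<longlonglongrightarrow> Lag (a, b, g)"
    unfolding Lag_eq H_def by (rule tendsto_add)
  moreover have "(\<lambda>j. Lag (u (Suc (q j)))) \<longlonglongrightarrow> l"
    using filterlim_compose[OF LIMSEQ_Suc[OF lim] q_top] .
  ultimately show ?thesis by (rule LIMSEQ_unique)
qed

lemma Lag_image_subseq_limits:
  assumes "(\<lambda>k. Lag (u k)) \<longlonglongrightarrow> l"
  shows "Lag ` subseq_limits u = {l}"
  using Lag_subseq_limit[OF assms] subseq_limits_nonempty[OF bounded_iterates] by force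

section \<open>Small subgradients at the iterates\<close>

text \<open>Each component is an optimality defect. Its \<alpha>-part arises because \<alpha> was
  optimal for the old \<open>c\<close> and \<gamma>, its c-part because \<open>c\<close> was optimal
  for the old \<gamma>, and its \<gamma>-part is the residual; all three are linear in the last
  change of \<open>c\<close>.\<close>

lemma Lag_subgradient:
  obtains M where "M > 0"
    "\<And>k. k > 0 \<Longrightarrow> \<exists>v\<in>limiting_subdiff Lag (u (Suc k)). norm v \<le> M * norm (c (Suc k) - c k)"
proof -
  define N where "N = onorm ((*v) A)"
  have N: "norm (A *v x) \<le> N * norm x" for x
    unfolding N_def by (rule onorm[OF matrix_vector_mul_bounded_linear])
  have "N \<ge> 0" unfolding N_def by (rule onorm_pos_le) simp
  define M where "M = (2 * lam + \<rho> * N) + (2 * lam * N + 2 * lam / \<rho>)"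
  show thesis
  proof (rule that[of M])
    show "M > 0" using lam rho \<open>N \<ge> 0\<close> by (auto simp: M_def intro!: add_pos_nonneg)
    fix k :: nat assume k: "k > 0"
    define a b g p where "a = \<alpha> (Suc k)" and "b = c (Suc k)" and "g = \<gamma> (Suc k)" and "p = a - A *v b"
    define d where "d = b - c k"
    have dg: "g - \<gamma> k = (2 * lam) *\<^sub>R d"
      using gamma_eq[OF k] gamma_eq[of "Suc k"] by (simp add: g_def b_def d_def algebra_simps)
    have dp: "\<rho> *\<^sub>R p = (2 * lam) *\<^sub>R d"
      using gamma_step[of k] dg by (simp add: p_def a_def b_def g_def)
    define v1 v2 where "v1 = (2 * lam) *\<^sub>R d - \<rho> *\<^sub>R (A *v d)" and "v2 = - (2 * lam) *\<^sub>R (A *v d)"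
    have v1: "v1 = g + \<rho> *\<^sub>R p - (\<gamma> k + \<rho> *\<^sub>R (a - A *v c k))"
      unfolding v1_def dg[symmetric]
      by (simp add: p_def d_def matrix_vector_mult_diff_distrib algebra_simps)
    have v2: "v2 = (2 * lam) *\<^sub>R (A *v b) - A *v g - \<rho> *\<^sub>R (A *v p)"
      using arg_cong[OF dp, of "(*v) A"] gamma_eq[of "Suc k"]
      by (simp add: v2_def g_def b_def matrix_vector_mult_scaleR)
    have "(v1, v2, p) \<in> limiting_subdiff Lag (a, b, g)"
    \<comment> \<open>The first summand pays for the minorant of \<open>F\<close> in the
      \<alpha>-direction, the second for the bilinear coupling in the \<gamma>-direction.\<close>
    proof (rule limiting_subdiff_quadratic_minorant[where M = "\<rho> / 2 + 1 / (2 * \<rho>)"])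
      fix w :: "(real^'n) \<times> (real^'n) \<times> (real^'n)"
      obtain a' b' g' where w: "w = (a', b', g')" by (cases w)
      define x y z where "x = a' - a" and "y = b' - b" and "z = g' - g"
      have w': "a' = a + x" "b' = b + y" "g' = g + z" by (simp_all add: x_def y_def z_def)
      define t where "t = a - A *v c k"
      \<comment> \<open>Solving the minimality inequality for \<open>F (a + x)\<close> gives
        \<open>F\<close> a quadratic minorant at \<open>a\<close>, with slope -(\<gamma> k + \<rho>
        t).\<close>
      have "Lag (a, c k, \<gamma> k) \<le> Lag (a + x, c k, \<gamma> k)"
        unfolding a_def by (rule alpha_min)
      moreover have "a + x - A *v c k = t + x" by (simp add: t_def)
      ultimately have "F a + \<gamma> k \<bullet> t + \<rho> / 2 * (norm t)\<^sup>2
          \<le> F (a + x) + \<gamma> k \<bullet> (t + x) + \<rho> / 2 * (norm (t + x))\<^sup>2"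
        by (simp add: aug_lagrangian_def t_def[symmetric])
      then have Fx: "F a - (\<gamma> k + \<rho> *\<^sub>R t) \<bullet> x - \<rho> / 2 * (norm x)\<^sup>2 \<le> F (a + x)"
        unfolding power2_norm_eq_inner by (simp add: inner_add inner_commute algebra_simps)
      have exp: "Lag (a + x, b + y, g + z) = F (a + x) - F a + Lag (a, b, g)
          + (g + \<rho> *\<^sub>R p) \<bullet> x + v2 \<bullet> y + p \<bullet> z
          + lam * (y \<bullet> (A *v y)) + z \<bullet> (x - A *v y) + \<rho> / 2 * (norm (x - A *v y))\<^sup>2"
      proof -
        have 1: "a + x - A *v (b + y) = p + (x - A *v y)"
          by (simp add: p_def matrix_vector_right_distrib)
        have 2: "(b + y) \<bullet> (A *v (b + y)) = b \<bullet> (A *v b) + 2 * ((A *v b) \<bullet> y) + y \<bullet> (A *v y)"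
          using A_inner[of b y] by (simp add: matrix_vector_right_distrib inner_add inner_commute)
        have 3: "(norm (p + (x - A *v y)))\<^sup>2
            = (norm p)\<^sup>2 + 2 * (p \<bullet> x) - 2 * ((A *v p) \<bullet> y) + (norm (x - A *v y))\<^sup>2"
          unfolding power2_norm_eq_inner A_inner[of p y, symmetric]
          by (simp add: inner_diff inner_add inner_commute algebra_simps)
        show ?thesis
          unfolding aug_lagrangian_def prod.case 1 2 3 v2 p_def[symmetric]
          using A_inner[of g y]
          by (simp add: inner_add inner_diff inner_commute algebra_simps)
      qed
      \<comment> \<open>The product of \<open>z\<close> with the change of the residual has no sign;
        completing the square with the penalty leaves a loss in \<open>z\<close> only.\<close>
      have yz: "- (1 / (2 * \<rho>)) * (norm z)\<^sup>2 \<le> z \<bullet> (x - A *v y) + \<rho> / 2 * (norm (x - A *v y))\<^sup>2"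
      proof -
        define h where "h = x - A *v y"
        have "(norm (z + \<rho> *\<^sub>R h))\<^sup>2 = (norm z)\<^sup>2 + 2 * \<rho> * (z \<bullet> h) + \<rho>\<^sup>2 * (norm h)\<^sup>2"
          unfolding power2_norm_eq_inner
          by (simp add: inner_add inner_commute power2_eq_square algebra_simps)
        then have "1 / (2 * \<rho>) * (norm (z + \<rho> *\<^sub>R h))\<^sup>2
            = 1 / (2 * \<rho>) * (norm z)\<^sup>2 + z \<bullet> h + \<rho> / 2 * (norm h)\<^sup>2"
          using rho by (simp add: field_simps power2_eq_square)
        moreover have "0 \<le> 1 / (2 * \<rho>) * (norm (z + \<rho> *\<^sub>R h))\<^sup>2" using rho by simp
        ultimately show ?thesis unfolding h_def by simp
      qed
      have diff: "w - (a, b, g) = (x, y, z)" by (simp add: w x_def y_def z_def)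
      have sq: "(norm (w - (a, b, g)))\<^sup>2 = (norm x)\<^sup>2 + (norm y)\<^sup>2 + (norm z)\<^sup>2"
        unfolding diff by (simp add: norm_Pair)
      have "\<rho> / 2 * (norm x)\<^sup>2 + 1 / (2 * \<rho>) * (norm z)\<^sup>2
          \<le> (\<rho> / 2 + 1 / (2 * \<rho>)) * (norm (w - (a, b, g)))\<^sup>2"
        unfolding sq using rho by (simp add: algebra_simps add_increasing)
      moreover have "0 \<le> lam * (y \<bullet> (A *v y))" using lam A_nonneg by simp
      moreover have "(v1, v2, p) \<bullet> (w - (a, b, g))
          = (g + \<rho> *\<^sub>R p) \<bullet> x - (\<gamma> k + \<rho> *\<^sub>R t) \<bullet> x + v2 \<bullet> y + p \<bullet> z"
        unfolding diff v1 t_def[symmetric] by (simp add: inner_diff_left)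
      ultimately show "Lag (a, b, g) + (v1, v2, p) \<bullet> (w - (a, b, g))
          - (\<rho> / 2 + 1 / (2 * \<rho>)) * (norm (w - (a, b, g)))\<^sup>2 \<le> Lag w"
        unfolding w w' exp[folded w'] using Fx yz exp w' by (simp add: w)
    qed
    moreover have "norm (v1, v2, p) \<le> M * norm d"
    proof -
      have "norm v1 \<le> norm ((2 * lam) *\<^sub>R d) + norm (\<rho> *\<^sub>R (A *v d))"
        unfolding v1_def by (rule norm_triangle_ineq4)
      also have "\<dots> \<le> 2 * lam * norm d + \<rho> * (N * norm d)"
        using lam rho N[of d] by simp
      finally have 1: "norm v1 \<le> 2 * lam * norm d + \<rho> * (N * norm d)" .
      have 2: "norm v2 \<le> 2 * lam * (N * norm d)"
        using lam N[of d] by (simp add: v2_def)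
      have "p = (1 / \<rho>) *\<^sub>R (\<rho> *\<^sub>R p)" using rho by simp
      then have 3: "norm p = 2 * lam / \<rho> * norm d"
        unfolding dp using lam rho by simp
      have "norm (v1, v2, p) \<le> norm v1 + (norm v2 + norm p)"
        using norm_Pair_le[of v1 "(v2, p)"] norm_Pair_le[of v2 p] by linarith
      then show ?thesis using 1 2 3 by (simp add: M_def algebra_simps)
    qed
    ultimately show "\<exists>v\<in>limiting_subdiff Lag (u (Suc k)). norm v \<le> M * norm (c (Suc k) - c k)"
      unfolding a_def b_def g_def d_def by blast
  qed
qed

section \<open>Rates for the coefficients\<close>

lemma KL_along_iterates:
  assumes KL: "KL_property Lag (subseq_limits u) (\<lambda>z. e * z powr (1 - \<theta>))"
    and e: "e > 0" and \<theta>: "0 \<le> \<theta>" "\<theta> < 1"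
    and lim: "(\<lambda>k. Lag (u k)) \<longlonglongrightarrow> l"
    and above: "\<And>k. k > 0 \<Longrightarrow> l < Lag (u k)"
  obtains B n where "B > 0"
    "\<And>k. k \<ge> n \<Longrightarrow> (Lag (u (Suc k)) - l) powr \<theta> \<le> B * norm (c (Suc k) - c k)"
proof -
  obtain \<epsilon> \<eta> where pos: "\<epsilon> > 0" "\<eta> > 0"
    and KL': "\<And>w v s. \<lbrakk>s \<in> subseq_limits u; dist w s < \<epsilon>; l < Lag w; Lag w < l + \<eta>;
       v \<in> limiting_subdiff Lag w; 0 \<le> deriv (\<lambda>z. e * z powr (1 - \<theta>)) (Lag w - l)\<rbrakk>
      \<Longrightarrow> 1 \<le> deriv (\<lambda>z. e * z powr (1 - \<theta>)) (Lag w - l) * norm v"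
  proof (rule KL_propertyE[OF KL Lag_image_subseq_limits[OF lim]], goal_cases)
    case (1 \<epsilon> \<eta>)
    from 1(2-) show thesis by (rule 1(1))
  qed
  obtain M where M: "M > 0"
    and sub: "\<And>k. k > 0 \<Longrightarrow> \<exists>v\<in>limiting_subdiff Lag (u (Suc k)). norm v \<le> M * norm (c (Suc k) - c k)"
    using Lag_subgradient by blast
  have "\<forall>\<^sub>F k in sequentially. \<exists>s\<in>subseq_limits u. dist (u k) s < \<epsilon>"
    by (rule eventually_near_subseq_limits[OF bounded_iterates pos(1)])
  moreover have "\<forall>\<^sub>F k in sequentially. Lag (u k) < l + \<eta>"
    using order_tendstoD(2)[OF lim, of "l + \<eta>"] pos(2) by simp
  ultimately have "\<forall>\<^sub>F k in sequentially. (\<exists>s\<in>subseq_limits u. dist (u k) s < \<epsilon>) \<and> Lag (u k) < l + \<eta>"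
    by (rule eventually_conj)
  then obtain n where n: "\<And>k. k \<ge> n \<Longrightarrow> (\<exists>s\<in>subseq_limits u. dist (u k) s < \<epsilon>) \<and> Lag (u k) < l + \<eta>"
    unfolding eventually_sequentially by blast
  \<comment> \<open>The derivative at the gap r is e (1-\<theta>) r^(-\<theta>), and the subgradient
    is at most \<open>M\<close> times the step; product \<ge> 1 is then solved for
    r^\<theta>.\<close>
  define B where "B = e * (1 - \<theta>) * M"
  show thesis
  proof
    show "B > 0" using e \<theta> M by (simp add: B_def)
    \<comment> \<open>The shift makes \<open>k\<close> positive, as the subgradient bound
      requires.\<close>
    fix k assume k: "k \<ge> n + 1"
    define r where "r = Lag (u (Suc k)) - l"
    have r: "r > 0" using above[of "Suc k"] by (simp add: r_def)
    have "((\<lambda>z. e * z powr (1 - \<theta>)) has_real_derivative e * ((1 - \<theta>) * r powr (1 - \<theta> - 1))) (at r)"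
      using r by (intro DERIV_cmult has_real_derivative_powr)
    then have der: "deriv (\<lambda>z. e * z powr (1 - \<theta>)) r = e * (1 - \<theta>) * r powr (- \<theta>)"
      by (simp add: DERIV_imp_deriv)
    obtain s where s: "s \<in> subseq_limits u" "dist (u (Suc k)) s < \<epsilon>" and small: "Lag (u (Suc k)) < l + \<eta>"
      using n[of "Suc k"] k by auto
    obtain v where v: "v \<in> limiting_subdiff Lag (u (Suc k))" "norm v \<le> M * norm (c (Suc k) - c k)"
      using sub[of k] k by auto
    have coeff: "0 \<le> e * (1 - \<theta>) * r powr (- \<theta>)" using e \<theta> by simp
    have "1 \<le> e * (1 - \<theta>) * r powr (- \<theta>) * norm v"
      using KL'[OF s _ small v(1)] above[of "Suc k"] coeff by (simp add: r_def[symmetric] der)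
    also have "\<dots> \<le> e * (1 - \<theta>) * r powr (- \<theta>) * (M * norm (c (Suc k) - c k))"
      using v(2) coeff by (rule mult_left_mono)
    also have "\<dots> = B * norm (c (Suc k) - c k) / r powr \<theta>"
      by (simp add: B_def powr_minus_divide)
    finally show "(Lag (u (Suc k)) - l) powr \<theta> \<le> B * norm (c (Suc k) - c k)"
      using r by (simp add: pos_le_divide_eq r_def)
  qed
qed

lemma coefficients_rate:
  assumes KL: "KL_property Lag (subseq_limits u) (\<lambda>z. e * z powr (1 - \<theta>))"
    and e: "e > 0" and \<theta>: "0 \<le> \<theta>" "\<theta> < 1"
  obtains b where "c \<longlonglongrightarrow> b"
    "\<theta> = 0 \<Longrightarrow> \<exists>n. \<forall>k>n. c k = b"
    "0 < \<theta> \<Longrightarrow> \<theta> \<le> 1/2 \<Longrightarrow>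
      \<exists>n. \<exists>C>0. \<exists>\<xi>. 0 \<le> \<xi> \<and> \<xi> < 1 \<and> (\<forall>k>n. norm (c k - b) \<le> C * \<xi> ^ k)"
    "1/2 < \<theta> \<Longrightarrow>
      \<exists>n. \<exists>C>0. \<forall>k>n. norm (c k - b) \<le> C * real k powr ((1 - \<theta>) / (1 - 2 * \<theta>))"
proof -
  obtain l where lim: "(\<lambda>k. Lag (u k)) \<longlonglongrightarrow> l" and ge: "\<And>k. k > 0 \<Longrightarrow> l \<le> Lag (u k)"
    by (rule Lag_limit) (rule that; blast)
  show thesis
  proof (cases "\<exists>k>0. Lag (u k) = l")
    case True
    then obtain k where k: "k > 0" "Lag (u k) = l" by blast
    have stat: "Lag (u (k + j)) = l \<and> c (k + j) = c k" for j
    proof (induction j)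
      case (Suc j)
      \<comment> \<open>The value cannot fall below \<open>l\<close>, so the descent inequality
        forces the step to vanish.\<close>
      have dsc: "Lag (u (Suc (k + j))) + decrease * (norm (c (Suc (k + j)) - c (k + j)))\<^sup>2 \<le> l"
        using descent[OF trans_less_add1[OF k(1), of j]] conjunct1[OF Suc] by linarith
      have "l \<le> Lag (u (Suc (k + j)))" by (rule ge) simp
      moreover have "0 \<le> decrease * (norm (c (Suc (k + j)) - c (k + j)))\<^sup>2"
        using decrease_pos by simp
      ultimately have "Lag (u (Suc (k + j))) = l" "decrease * (norm (c (Suc (k + j)) - c (k + j)))\<^sup>2 = 0"
        using dsc by linarith+
      then show ?case using decrease_pos Suc by simp
    qed (use k in simp)
    then have const: "c j = c k" if "j > k" for j
      using that by (metis le_add_diff_inverse less_imp_le)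
    show thesis
    proof (rule that[of "c k"])
      show "c \<longlonglongrightarrow> c k"
        using const by (intro tendsto_eventually) (auto simp: eventually_at_top_dense)
      show "\<exists>n. \<forall>j>n. c j = c k" using const by blast
      show "\<exists>n. \<exists>C>0. \<exists>\<xi>. 0 \<le> \<xi> \<and> \<xi> < 1 \<and> (\<forall>j>n. norm (c j - c k) \<le> C * \<xi> ^ j)"
        using const by (intro exI[of _ k] exI[of _ "1::real"] exI[of _ "0::real"]) auto
      show "\<exists>n. \<exists>C>0. \<forall>j>n. norm (c j - c k) \<le> C * real j powr ((1 - \<theta>) / (1 - 2 * \<theta>))"
        using const by (intro exI[of _ k] exI[of _ "1::real"]) auto
    qed
  next
    case False
    have above: "l < Lag (u k)" if "k > 0" for k
    proof -
      have "Lag (u k) \<noteq> l" using False that by blast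
      then show ?thesis using ge[OF that] by simp
    qed
    obtain B n0 where B: "B > 0"
      and KL0: "\<And>k. k \<ge> n0 \<Longrightarrow> (Lag (u (Suc k)) - l) powr \<theta> \<le> B * norm (c (Suc k) - c k)"
      by (rule KL_along_iterates[OF KL e \<theta> lim above]) (assumption | (rule that; blast))+
    define r where "r k = Lag (u k) - l" for k
    \<comment> \<open>Gaps of at most 1 make powers antitone in the exponent.\<close>
    have "\<forall>\<^sub>F k in sequentially. Lag (u k) < l + 1"
      using order_tendstoD(2)[OF lim, of "l + 1"] by simp
    then obtain n1 where n1: "\<And>k. k \<ge> n1 \<Longrightarrow> Lag (u k) < l + 1"
      unfolding eventually_sequentially by blast
    define n where "n = max (Suc n0) n1"
    have r_pos: "0 < r k" and r_le: "r k \<le> 1"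
      and dsc: "decrease * (norm (c (Suc k) - c k))\<^sup>2 \<le> r k - r (Suc k)"
      and KLr: "r (Suc k) powr \<theta> \<le> B * norm (c (Suc k) - c k)" if "k \<ge> n" for k
    proof -
      have k: "k > 0" "k \<ge> n0" "k \<ge> n1" using that by (auto simp: n_def)
      show "0 < r k" "r k \<le> 1" using above[OF k(1)] n1[OF k(3)] by (simp_all add: r_def)
      show "decrease * (norm (c (Suc k) - c k))\<^sup>2 \<le> r k - r (Suc k)"
        using descent[OF k(1)] by (simp add: r_def)
      show "r (Suc k) powr \<theta> \<le> B * norm (c (Suc k) - c k)"
        using KL0[OF k(2)] by (simp add: r_def)
    qed
    \<comment> \<open>With exponent 0 the inequality would keep all late steps above 1 /
      \<open>B\<close>, although they vanish. Positivity of \<open>r\<close> matters, since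
      \<open>0 powr 0\<close> is 0.\<close>
    have "\<theta> \<noteq> 0"
    proof
      assume "\<theta> = 0"
      then have "1 / B \<le> norm (c (Suc k) - c k)" if "k \<ge> n" for k
        using KLr[OF that] r_pos[of "Suc k"] that B by (simp add: field_simps)
      moreover have "(\<lambda>k. norm (c (Suc k) - c k)) \<longlonglongrightarrow> 0"
        using c_step_tendsto_0 by (rule tendsto_norm_zero)
      ultimately have "1 / B \<le> 0"
        by (intro tendsto_lowerbound[of "\<lambda>k. norm (c (Suc k) - c k)" 0 sequentially])
          (auto simp: eventually_sequentially)
      then show False using B by simp
    qed
    show thesis
    proof (cases "\<theta> \<le> 1/2")
      case True
      \<comment> \<open>Every exponent up to 1/2 is raised to 1/2, which only weakens the
        bound.\<close>
      have "r (Suc k) powr (1/2) \<le> B * norm (c (Suc k) - c k)" if k: "k \<ge> n" for k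
      proof -
        have "r (Suc k) powr (1/2) \<le> r (Suc k) powr \<theta>"
          using r_pos[of "Suc k"] r_le[of "Suc k"] k True by (intro powr_mono') auto
        then show ?thesis using KLr[OF k] by linarith
      qed
      note KL_half = this
      obtain b C \<xi> where "c \<longlonglongrightarrow> b" "C > 0" "0 \<le> \<xi>" "\<xi> < 1"
        "\<And>k. k > n \<Longrightarrow> norm (c k - b) \<le> C * \<xi> ^ k"
        by (rule KL_linear_rate[where x = c and r = r and n = n, OF decrease_pos B r_pos r_le dsc KL_half]) (assumption | (rule that; blast))+
      then show thesis using that[of b] True \<open>\<theta> \<noteq> 0\<close> by force
    next
      case False
      then have half: "1/2 < \<theta>" by simp
      obtain b C where "c \<longlonglongrightarrow> b" "C > 0"
        "\<And>k. k > 2 * n + 2 \<Longrightarrow> norm (c k - b) \<le> C * real k powr ((1 - \<theta>) / (1 - 2 * \<theta>))"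
        by (rule KL_sublinear_rate[where x = c and r = r and n = n,
              OF decrease_pos B half \<theta>(2) r_pos r_le dsc KLr]) (assumption | (rule that; blast))+
      then show thesis using that[of b] False \<open>\<theta> \<noteq> 0\<close> by force
    qed
  qed
qed

end

section \<open>Transfer to the Hilbert space\<close>

text \<open>Values on X determine an element, so a function prescribed as a kernel expansion is the
  same combination of fixed vectors, the representers of the data points. This exhibits
  \<open>s\<close> as a linear image of \<open>c\<close>.\<close>

lemma kernel_expansion:
  fixes ev :: "'h::{real_inner,complete_space} \<Rightarrow> 'x \<Rightarrow> real" and xs :: "'n::finite \<Rightarrow> 'x"
  assumes "rkhs X ev K" "\<And>i. xs i \<in> X"
  obtains rep where "\<forall>f a. (\<forall>t\<in>X. ev f t = (\<Sum>i\<in>UNIV. a i * K (xs i) t))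
    \<longrightarrow> f = (\<Sum>i\<in>UNIV. a i *\<^sub>R rep i)"
proof -
  note rkhs = assms(1)[unfolded rkhs_def]
  have lin: "linear (\<lambda>f. ev f t)" if "t \<in> X" for t
    using conjunct1[OF rkhs] that by (rule bspec)
  have inj: "f = g" if "\<And>t. t \<in> X \<Longrightarrow> ev f t = ev g t" for f g
    using conjunct1[OF conjunct2[OF rkhs]] that by simp
  have ex: "\<exists>k. \<forall>t\<in>X. ev k t = K x t" if "x \<in> X" for x
    using conjunct2[OF conjunct2[OF rkhs]] that by fast
  obtain rep where rep: "\<And>i t. t \<in> X \<Longrightarrow> ev (rep i) t = K (xs i) t"
    using ex[OF assms(2)] by metis
  show thesis
  proof (rule that[of rep], intro allI impI, rule inj)
    fix f a t
    assume f: "\<forall>t\<in>X. ev f t = (\<Sum>i\<in>UNIV. a i * K (xs i) t)" and t: "t \<in> X"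
    have "ev (\<Sum>i\<in>UNIV. a i *\<^sub>R rep i) t = (\<Sum>i\<in>UNIV. a i *\<^sub>R ev (rep i) t)"
      by (simp add: linear_sum[OF lin[OF t]] linear_scale[OF lin[OF t]])
    then show "ev f t = ev (\<Sum>i\<in>UNIV. a i *\<^sub>R rep i) t" using f t rep[OF t] by simp
  qed
qed

theorem proposition4p4:
  fixes X :: "(real^'d) set"
    and ev :: "'h::{real_inner,complete_space} \<Rightarrow> real^'d \<Rightarrow> real"
    and K :: "real^'d \<Rightarrow> real^'d \<Rightarrow> real"
    and L :: "real^'d \<Rightarrow> real \<Rightarrow> real \<Rightarrow> real"
    and xs :: "'n::finite \<Rightarrow> real^'d"
    and ys :: "'n \<Rightarrow> real"
    and A :: "real^'n^'n"
    and lam \<rho> e \<theta> :: real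
    and \<alpha> c \<gamma> :: "nat \<Rightarrow> real^'n"
    and s :: "nat \<Rightarrow> 'h"
    and sstar :: 'h
    and F :: "real^'n \<Rightarrow> real"
    and S :: "((real^'n) \<times> (real^'n) \<times> (real^'n)) set"
  assumes rkhs: "rkhs X ev K"
    and lam: "lam > 0"
    and rho: "\<rho> > 0"
    and data: "\<And>i. xs i \<in> X" "\<And>i. ys i \<in> {1, -1}"
    and A: "A = kernel_matrix K xs"
    and L_nonneg: "\<And>x y t. x \<in> X \<Longrightarrow> y \<in> {1, -1} \<Longrightarrow> L x y t \<ge> 0"
    and L_lsc: "\<And>x y. x \<in> X \<Longrightarrow> y \<in> {1, -1} \<Longrightarrow> lsc (L x y)"
    and L_subanalytic:
      "\<And>x y. x \<in> X \<Longrightarrow> y \<in> {1, -1} \<Longrightarrow> subanalytic_fun 1 (\<lambda>p. L x y (p 0))"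
    and L_subdiff: "\<And>x y. x \<in> X \<Longrightarrow> y \<in> {1, -1} \<Longrightarrow> 0 \<notin> limiting_subdiff (L x y) 0"
    and A_symmetric: "transpose A = A"
    and A_pos_def: "strictly_pos_def A"
    and rho_large: "\<rho> > 4 * lam * onorm ((*v) (matrix_inv A))"
    and F: "F = empirical_loss L xs ys"
    and iterates: "splitting_iterates F A lam \<rho> \<alpha> c \<gamma>"
    and s: "\<And>k t. t \<in> X \<Longrightarrow> ev (s (Suc k)) t = (\<Sum>i\<in>UNIV. c (Suc k) $ i * K (xs i) t)"
    and sstar: "sstar = lim s"
    and S: "S = subseq_limits (\<lambda>k. (\<alpha> k, c k, \<gamma> k))"
    and e: "e > 0"
    and theta: "0 \<le> \<theta>" "\<theta> < 1"
    and KL: "KL_property (aug_lagrangian F A lam \<rho>) S (\<lambda>z. e * z powr (1 - \<theta>))"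
  shows "(\<theta> = 0 \<longrightarrow> (\<exists>n1::nat. \<forall>k>n1. s k = sstar)) \<and>
    (0 < \<theta> \<and> \<theta> \<le> 1/2 \<longrightarrow>
      (\<exists>n2::nat. \<exists>C1>0. \<exists>\<xi>. 0 \<le> \<xi> \<and> \<xi> < 1 \<and>
        (\<forall>k>n2. norm (s k - sstar) \<le> C1 * \<xi> ^ k))) \<and>
    (1/2 < \<theta> \<and> \<theta> < 1 \<longrightarrow>
      (\<exists>n3::nat. \<exists>C2>0. \<forall>k>n3.
        norm (s k - sstar) \<le> C2 * real k powr ((1 - \<theta>) / (1 - 2 * \<theta>))))"
proof -
  interpret splitting_method F A lam \<rho> \<alpha> c \<gamma>
  proof
    show "0 \<le> F a" for a
      unfolding F empirical_loss_def using L_nonneg data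
      by (intro mult_nonneg_nonneg sum_nonneg) auto
    show "lsc F"
      unfolding F using L_lsc data by (intro lsc_empirical_loss) auto
  qed fact+
  obtain rep where rep: "\<forall>f a. (\<forall>t\<in>X. ev f t = (\<Sum>i\<in>UNIV. a i * K (xs i) t))
    \<longrightarrow> f = (\<Sum>i\<in>UNIV. a i *\<^sub>R rep i)"
    by (rule kernel_expansion[OF rkhs data(1)])
  obtain b where b: "c \<longlonglongrightarrow> b"
    and finite: "\<theta> = 0 \<Longrightarrow> \<exists>n. \<forall>k>n. c k = b"
    and linear: "0 < \<theta> \<Longrightarrow> \<theta> \<le> 1/2 \<Longrightarrow>
      \<exists>n. \<exists>C>0. \<exists>\<xi>. 0 \<le> \<xi> \<and> \<xi> < 1 \<and> (\<forall>k>n. norm (c k - b) \<le> C * \<xi> ^ k)"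
    and sublinear: "1/2 < \<theta> \<Longrightarrow>
      \<exists>n. \<exists>C>0. \<forall>k>n. norm (c k - b) \<le> C * real k powr ((1 - \<theta>) / (1 - 2 * \<theta>))"
    by (rule coefficients_rate[OF KL[unfolded S] e theta]) (rule that; blast)
  define T where "T v = (\<Sum>i\<in>UNIV. (v $ i) *\<^sub>R rep i)" for v :: "real^'n"
  have s_eq: "s k = T (c k)" if "k > 0" for k
  proof -
    have "ev (s k) t = (\<Sum>i\<in>UNIV. c k $ i * K (xs i) t)" if "t \<in> X" for t
      using s[OF that, of "k - 1"] \<open>k > 0\<close> by simp
    then show ?thesis using rep[rule_format, of "s k" "\<lambda>i. c k $ i"] by (simp add: T_def)
  qed
  have "(\<lambda>k. T (c (Suc k))) \<longlonglongrightarrow> T b"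
    unfolding T_def by (intro tendsto_intros LIMSEQ_Suc[OF b])
  then have "(\<lambda>k. s (Suc k)) \<longlonglongrightarrow> T b" by (simp add: s_eq)
  then have "sstar = T b"
    unfolding sstar by (intro limI) (rule LIMSEQ_imp_Suc)
  \<comment> \<open>A Lipschitz constant of \<open>T\<close>; the summand 1 keeps it positive even
    if all representers vanish.\<close>
  define R where "R = 1 + (\<Sum>i\<in>UNIV. norm (rep i))"
  have R: "R > 0" unfolding R_def by (intro add_pos_nonneg sum_nonneg) auto
  have dist: "norm (s k - sstar) \<le> R * norm (c k - b)" if "k > 0" for k
  proof -
    have "s k - sstar = (\<Sum>i\<in>UNIV. ((c k - b) $ i) *\<^sub>R rep i)"
      unfolding s_eq[OF that] \<open>sstar = T b\<close> T_def by (simp add: scaleR_left_diff_distrib sum_subtractf)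
    also have "norm \<dots> \<le> (\<Sum>i\<in>UNIV. norm (c k - b) * norm (rep i))"
    proof (rule sum_norm_le)
      show "norm (((c k - b) $ i) *\<^sub>R rep i) \<le> norm (c k - b) * norm (rep i)" for i
        unfolding norm_scaleR using component_le_norm_cart[of "c k - b" i]
        by (intro mult_right_mono) auto
    qed
    also have "\<dots> \<le> R * norm (c k - b)"
      unfolding R_def sum_distrib_left[symmetric] by (simp add: algebra_simps)
    finally show ?thesis .
  qed
  have scale: "norm (s k - sstar) \<le> (R * C) * y" if "norm (c k - b) \<le> C * y" "k > 0" for k C y
  proof -
    have "R * norm (c k - b) \<le> R * (C * y)" using that(1) R by (intro mult_left_mono) auto
    then show ?thesis using dist[OF that(2)] by (simp add: mult.assoc)
  qed
  show ?thesis
  proof (intro conjI impI)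
    assume "\<theta> = 0"
    then obtain n where "\<forall>k>n. c k = b" using finite by blast
    then show "\<exists>n1::nat. \<forall>k>n1. s k = sstar"
      using s_eq \<open>sstar = T b\<close> by (metis gr_zeroI not_less_zero)
  next
    assume "0 < \<theta> \<and> \<theta> \<le> 1/2"
    then obtain n C \<xi> where C: "C > 0" "0 \<le> \<xi>" "\<xi> < 1" "\<And>k. k > n \<Longrightarrow> norm (c k - b) \<le> C * \<xi> ^ k"
      using linear by metis
    have "norm (s k - sstar) \<le> (R * C) * \<xi> ^ k" if "k > n" for k
      using C(4)[OF that] that by (intro scale) auto
    then show "\<exists>n2::nat. \<exists>C1>0. \<exists>\<xi>. 0 \<le> \<xi> \<and> \<xi> < 1 \<and>
        (\<forall>k>n2. norm (s k - sstar) \<le> C1 * \<xi> ^ k)"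
      using C R by (intro exI[of _ n] exI[of _ "R * C"] conjI exI[of _ \<xi>]) auto
  next
    assume "1/2 < \<theta> \<and> \<theta> < 1"
    then obtain n C where C: "C > 0"
      "\<And>k. k > n \<Longrightarrow> norm (c k - b) \<le> C * real k powr ((1 - \<theta>) / (1 - 2 * \<theta>))"
      using sublinear by metis
    have "norm (s k - sstar) \<le> (R * C) * real k powr ((1 - \<theta>) / (1 - 2 * \<theta>))" if "k > n" for k
      using C(2)[OF that] that by (intro scale) auto
    then show "\<exists>n3::nat. \<exists>C2>0. \<forall>k>n3.
        norm (s k - sstar) \<le> C2 * real k powr ((1 - \<theta>) / (1 - 2 * \<theta>))"
      using C R by (intro exI[of _ n] exI[of _ "R * C"]) auto
  qed
qed

end
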